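(* Consider the following algorithm. Choose $w_h^{-1}\in\mathbb V_h^0$ and set $\boldsymbol\alpha_0=\boldsymbol\alpha(w_h^{-1})$. For $k\ge0$, let $w_h^k\in\mathbb V_h^0$ solve $\mathfrak F_{h,\varepsilon}^{\boldsymbol\alpha_k}[w_h^k](z)=f_z$ for all $z\in\mathcal N_h$, and set $\boldsymbol\alpha_{k+1}=\boldsymbol\alpha(w_h^k)$. Then the sequence $\{w_h^k\}_{k\ge0}\subset\mathbb V_h^0$ converges in a finite number of steps to $u_h^\varepsilon\in\mathbb V_h^0$, the solution of \[ \frac\lambda2\Delta_hu_h^\varepsilon(z)+\inf_{\alpha\in\mathcal A}\sup_{\beta\in\mathcal B}I_\varepsilon^{\alpha,\beta}[u_h^\varepsilon](z)=f_z\qquad\forall z\in\mathcal N_h. \]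
   Context: Setting: $\Omega\subset\mathbb{R}^d$ ($d\ge2$) open, bounded, convex; $f\in C^{0,1}(\bar\Omega)$; $\mathcal A,\mathcal B$ finite nonempty sets; $A^{\alpha,\beta}\in C^{0,1}(\bar\Omega)$ symmetric-matrix-valued with $\lambda I\le A^{\alpha,\beta}\le\Lambda I$, $0<\lambda\le\Lambda$; $M^{\alpha,\beta}(x)=(A^{\alpha,\beta}(x)-\frac\lambda2 I)^{1/2}$. $\varphi$ is a fixed radially symmetric smooth function supported in the unit ball with $\int|y|^2\varphi(y)dy=d$. $\varepsilon>0$; $Q=\sqrt{2/\lambda}$, $\Omega_\varepsilon=\Omega\cup\{x:\operatorname{dist}(x,\partial\Omega)\le Q\varepsilon\}$. For $w\in C(\bar\Omega_\varepsilon)$, $\delta w(x,y)=w(x+y)-2w(x)+w(x-y)$ and $I_\varepsilon^{\alpha,\beta}[w](x)=\frac{1}{\varepsilon^{d+2}\det M^{\alpha,\beta}(x)}\int_{\mathbb{R}^d}\delta w(x,y)\varphi(\varepsilon^{-1}M^{\alpha,\beta}(x)^{-1}y)\,dy$. $\mathcal T_h$ is a weakly acute (all dihedral angles at most $\pi/2$) quasi-uniform simplicial mesh of $\Omega$ of size $h$ with interior nodes $\mathcal N_h$; $\mathbb V_h^0$ = continuous piecewise-linear functions on $\mathcal T_h$ vanishing on $\partial\Omega$, extended by zero to $\Omega_\varepsilon$, nodal basis $\{\phi_z\}$. $\Delta_hw_h(z)=-\left(\int_\Omega\phi_z\right)^{-1}\int_\Omega\nabla w_h\cdot\nabla\phi_z$,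 $f_z=\left(\int_\Omega\phi_z\right)^{-1}\int_\Omega f\phi_z$. For $w_h\in\mathbb V_h^0$ and $z\in\mathcal N_h$, $\alpha(w_h,z)\in\mathcal A$ is an element attaining the infimum: $\inf_{\alpha\in\mathcal A}\sup_{\beta}I_\varepsilon^{\alpha,\beta}[w_h](z)=\sup_\beta I_\varepsilon^{\alpha(w_h,z),\beta}[w_h](z)$, and $\boldsymbol\alpha(w_h)=(\alpha(w_h,z))_{z\in\mathcal N_h}$. For $\boldsymbol\alpha=(\alpha_z)_{z\in\mathcal N_h}$, $\mathfrak F_{h,\varepsilon}^{\boldsymbol\alpha}[w_h](z)=\frac\lambda2\Delta_hw_h(z)+\sup_{\beta\in\mathcal B}I_\varepsilon^{\alpha_z,\beta}[w_h](z)$.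
   Formalization: The kernel φ is additionally assumed nonnegative; for sign-changing φ the operator on the discrete space can vanish identically, so that with f = 0 the iterates are arbitrary and the claim fails. *)

theory Defs
  imports "HOL-Analysis.Analysis"
begin

text \<open>A simplex of the mesh is represented by its (finite) vertex set S; the closed
element is convex hull S.  A mesh is a set of vertex sets.\<close>

definition is_simplex :: "(real^'n) set \<Rightarrow> bool" where
  "is_simplex S \<longleftrightarrow> finite S \<and> card S = CARD('n) + 1 \<and> \<not> affine_dependent S"

definition facet_normal :: "(real^'n) set \<Rightarrow> real^'n \<Rightarrow> real^'n" where
  "facet_normal S v = (THE n. norm n = 1 \<and>
      (\<forall>p\<in>S - {v}. \<forall>q\<in>S - {v}. n \<bullet> (p - q) = 0) \<and>
      (\<forall>p\<in>S - {v}. n \<bullet> (v - p) < 0))"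

definition dihedral_angle :: "(real^'n) set \<Rightarrow> real^'n \<Rightarrow> real^'n \<Rightarrow> real" where
  "dihedral_angle S v w = pi - arccos (facet_normal S v \<bullet> facet_normal S w)"

definition simplicial_mesh :: "(real^'n) set set \<Rightarrow> (real^'n) set \<Rightarrow> bool" where
  "simplicial_mesh \<T> \<Omega> \<longleftrightarrow> finite \<T> \<and> \<T> \<noteq> {} \<and> (\<forall>S\<in>\<T>. is_simplex S) \<and>
     \<Union> ((\<lambda>S. convex hull S) ` \<T>) = closure \<Omega> \<and>
     (\<forall>S\<in>\<T>. \<forall>S'\<in>\<T>. convex hull S \<inter> convex hull S' = convex hull (S \<inter> S'))"

definition weakly_acute :: "(real^'n) set set \<Rightarrow> bool" where
  "weakly_acute \<T> \<longleftrightarrow>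
     (\<forall>S\<in>\<T>. \<forall>v\<in>S. \<forall>w\<in>S. v \<noteq> w \<longrightarrow> dihedral_angle S v w \<le> pi / 2)"

definition quasi_uniform :: "(real^'n) set set \<Rightarrow> real \<Rightarrow> real \<Rightarrow> bool" where
  "quasi_uniform \<T> h \<sigma> \<longleftrightarrow> 0 < h \<and> 0 < \<sigma> \<and>
     (\<forall>S\<in>\<T>. diameter (convex hull S) \<le> h \<and>
        (\<exists>c r. h / \<sigma> \<le> r \<and> ball c r \<subseteq> convex hull S))"

definition interior_nodes :: "(real^'n) set set \<Rightarrow> (real^'n) set \<Rightarrow> (real^'n) set" where
  "interior_nodes \<T> \<Omega> = {z \<in> \<Union>\<T>. z \<in> \<Omega>}"

definition V0 :: "(real^'n) set set \<Rightarrow> (real^'n) set \<Rightarrow> (real^'n \<Rightarrow> real) set" where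
  "V0 \<T> \<Omega> = {w. continuous_on (closure \<Omega>) w \<and>
      (\<forall>S\<in>\<T>. \<exists>a b. \<forall>x\<in>convex hull S. w x = a \<bullet> x + b) \<and>
      (\<forall>x. x \<notin> \<Omega> \<longrightarrow> w x = 0)}"

definition hat :: "(real^'n) set set \<Rightarrow> (real^'n) set \<Rightarrow> real^'n \<Rightarrow> real^'n \<Rightarrow> real" where
  "hat \<T> \<Omega> z = (THE \<phi>. \<phi> \<in> V0 \<T> \<Omega> \<and> \<phi> z = 1 \<and>
      (\<forall>z'\<in>interior_nodes \<T> \<Omega> - {z}. \<phi> z' = 0))"

definition grad :: "(real^'n \<Rightarrow> real) \<Rightarrow> real^'n \<Rightarrow> real^'n" where
  "grad w x = (SOME g. (w has_derivative (\<lambda>v. g \<bullet> v)) (at x))"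

definition disc_lap ::
  "(real^'n) set set \<Rightarrow> (real^'n) set \<Rightarrow> (real^'n \<Rightarrow> real) \<Rightarrow> real^'n \<Rightarrow> real" where
  "disc_lap \<T> \<Omega> w z =
     - (LINT x:\<Omega>|lebesgue. grad w x \<bullet> grad (hat \<T> \<Omega> z) x) /
       (LINT x:\<Omega>|lebesgue. hat \<T> \<Omega> z x)"

definition node_val ::
  "(real^'n) set set \<Rightarrow> (real^'n) set \<Rightarrow> (real^'n \<Rightarrow> real) \<Rightarrow> real^'n \<Rightarrow> real" where
  "node_val \<T> \<Omega> f z =
     (LINT x:\<Omega>|lebesgue. f x * hat \<T> \<Omega> z x) / (LINT x:\<Omega>|lebesgue. hat \<T> \<Omega> z x)"

definition sym_mat :: "real^'n^'n \<Rightarrow> bool" where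
  "sym_mat B \<longleftrightarrow> transpose B = B"

definition psd_mat :: "real^'n^'n \<Rightarrow> bool" where
  "psd_mat B \<longleftrightarrow> (\<forall>v. 0 \<le> v \<bullet> (B *v v))"

definition mat_sqrt :: "real^'n^'n \<Rightarrow> real^'n^'n" where
  "mat_sqrt B = (THE R. sym_mat R \<and> psd_mat R \<and> R ** R = B)"

definition Mcoef :: "real \<Rightarrow> (real^'n \<Rightarrow> real^'n^'n) \<Rightarrow> real^'n \<Rightarrow> real^'n^'n" where
  "Mcoef lam A x = mat_sqrt (A x - (lam / 2) *\<^sub>R mat 1)"

definition partial :: "'n \<Rightarrow> (real^'n \<Rightarrow> real) \<Rightarrow> real^'n \<Rightarrow> real" where
  "partial i g x = deriv (\<lambda>t. g (x + t *\<^sub>R axis i 1)) 0"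

definition C_infty :: "(real^'n \<Rightarrow> real) \<Rightarrow> bool" where
  "C_infty g \<longleftrightarrow> (\<forall>is :: 'n list. continuous_on UNIV (fold partial is g) \<and>
     (\<forall>i x. (\<lambda>t. fold partial is g (x + t *\<^sub>R axis i 1)) differentiable (at 0)))"

definition second_diff :: "(real^'n \<Rightarrow> real) \<Rightarrow> real^'n \<Rightarrow> real^'n \<Rightarrow> real" where
  "second_diff w x y = w (x + y) - 2 * w x + w (x - y)"

definition I_eps ::
  "(real^'n \<Rightarrow> real) \<Rightarrow> real \<Rightarrow> real \<Rightarrow> (real^'n \<Rightarrow> real^'n^'n) \<Rightarrow> (real^'n \<Rightarrow> real)
     \<Rightarrow> real^'n \<Rightarrow> real" where
  "I_eps \<phi> lam \<epsilon> A w x =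
     (LINT y|lebesgue. second_diff w x y *
        \<phi> ((1 / \<epsilon>) *\<^sub>R (matrix_inv (Mcoef lam A x) *v y))) /
     (\<epsilon> ^ (CARD('n) + 2) * det (Mcoef lam A x))"

definition sup_I ::
  "(real^'n \<Rightarrow> real) \<Rightarrow> real \<Rightarrow> real \<Rightarrow> ('a \<Rightarrow> 'b \<Rightarrow> real^'n \<Rightarrow> real^'n^'n) \<Rightarrow> 'b set
     \<Rightarrow> 'a \<Rightarrow> (real^'n \<Rightarrow> real) \<Rightarrow> real^'n \<Rightarrow> real" where
  "sup_I \<phi> lam \<epsilon> A \<B> \<alpha> w z = Max ((\<lambda>\<beta>. I_eps \<phi> lam \<epsilon> (A \<alpha> \<beta>) w z) ` \<B>)"

definition inf_sup_I ::
  "(real^'n \<Rightarrow> real) \<Rightarrow> real \<Rightarrow> real \<Rightarrow> ('a \<Rightarrow> 'b \<Rightarrow> real^'n \<Rightarrow> real^'n^'n) \<Rightarrow> 'a set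
     \<Rightarrow> 'b set \<Rightarrow> (real^'n \<Rightarrow> real) \<Rightarrow> real^'n \<Rightarrow> real" where
  "inf_sup_I \<phi> lam \<epsilon> A \<A> \<B> w z = Min ((\<lambda>\<alpha>. sup_I \<phi> lam \<epsilon> A \<B> \<alpha> w z) ` \<A>)"

text \<open>a is an admissible choice of \<alpha>(w,z): an element of \<A> attaining the infimum.\<close>
definition attains_inf ::
  "(real^'n \<Rightarrow> real) \<Rightarrow> real \<Rightarrow> real \<Rightarrow> ('a \<Rightarrow> 'b \<Rightarrow> real^'n \<Rightarrow> real^'n^'n) \<Rightarrow> 'a set
     \<Rightarrow> 'b set \<Rightarrow> (real^'n \<Rightarrow> real) \<Rightarrow> real^'n \<Rightarrow> 'a \<Rightarrow> bool" where
  "attains_inf \<phi> lam \<epsilon> A \<A> \<B> w z a \<longleftrightarrow>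
     a \<in> \<A> \<and> sup_I \<phi> lam \<epsilon> A \<B> a w z = inf_sup_I \<phi> lam \<epsilon> A \<A> \<B> w z"

definition F_pol ::
  "(real^'n) set set \<Rightarrow> (real^'n) set \<Rightarrow> (real^'n \<Rightarrow> real) \<Rightarrow> real \<Rightarrow> real
     \<Rightarrow> ('a \<Rightarrow> 'b \<Rightarrow> real^'n \<Rightarrow> real^'n^'n) \<Rightarrow> 'b set \<Rightarrow> (real^'n \<Rightarrow> 'a)
     \<Rightarrow> (real^'n \<Rightarrow> real) \<Rightarrow> real^'n \<Rightarrow> real" where
  "F_pol \<T> \<Omega> \<phi> lam \<epsilon> A \<B> pol w z =
     (lam / 2) * disc_lap \<T> \<Omega> w z + sup_I \<phi> lam \<epsilon> A \<B> (pol z) w z"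

definition F_isaacs ::
  "(real^'n) set set \<Rightarrow> (real^'n) set \<Rightarrow> (real^'n \<Rightarrow> real) \<Rightarrow> real \<Rightarrow> real
     \<Rightarrow> ('a \<Rightarrow> 'b \<Rightarrow> real^'n \<Rightarrow> real^'n^'n) \<Rightarrow> 'a set \<Rightarrow> 'b set
     \<Rightarrow> (real^'n \<Rightarrow> real) \<Rightarrow> real^'n \<Rightarrow> real" where
  "F_isaacs \<T> \<Omega> \<phi> lam \<epsilon> A \<A> \<B> w z =
     (lam / 2) * disc_lap \<T> \<Omega> w z + inf_sup_I \<phi> lam \<epsilon> A \<A> \<B> w z"

end

theory Submission
  imports Defs
begin

text \<open>Both the operator of a fixed policy and the Isaacs operator satisfy a comparison principle:
  if \<open>F[u] \<ge> F[v]\<close> at the interior nodes, then \<open>u \<le> v\<close>. Indeed, the nonlocal terms are ordered at a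
  global maximum of \<open>u - v\<close>, and a positive maximum is excluded by weak acuteness of the mesh.
  The greedy choice of the policy gives \<open>F\<^sup>k\<^sup>+\<^sup>1[w\<^sup>k] \<le> F\<^sup>k[w\<^sup>k] = f = F\<^sup>k\<^sup>+\<^sup>1[w\<^sup>k\<^sup>+\<^sup>1]\<close>, so the iterates
  decrease. An iterate is determined by its policy on the finitely many nodes, so some iterate
  recurs infinitely often, and by monotonicity the sequence is constant from its first occurrence.
  A stationary iterate solves the Isaacs equation since its own greedy policy produced it.\<close>

section \<open>Square roots of positive definite matrices\<close>

text \<open>The integral operators see points outside the mesh, so ordering them at a node requires
  a maximum of \<open>u - v\<close> over the whole space; a positive nodal maximum is one because
  functions in \<open>V0\<close> vanish off the domain. The ordering also divides by
  \<open>det (Mcoef lam A x)\<close> and integrates a kernel built from the inverse of that matrix.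
  Since \<open>mat_sqrt\<close> is a definite description, nothing is known about
  \<open>Mcoef\<close> until existence and uniqueness of the square root are proved. The inf-sup
  operator is in general neither convex nor concave. Only the order properties of \<open>Max\<close>
  and \<open>Min\<close> are used, so no linearisation is involved. The solution of the Isaacs
  equation is not constructed separately: the stationary iterate supplies its existence, and
  comparison its uniqueness.\<close>

lemma symmetric_blinfun_norm_bound:
  fixes E :: "'a::real_inner \<Rightarrow>\<^sub>L 'a"
  assumes sym: "\<And>x y. E x \<bullet> y = x \<bullet> E y" and q: "0 < q"
    and form: "\<And>x. 0 \<le> x \<bullet> E x" "\<And>x. x \<bullet> E x \<le> q * (x \<bullet> x)"
  shows "norm E \<le> q"
proof (rule norm_blinfun_bound)
  fix x
  let ?y = "E x"
  \<comment> \<open>Along \<open>x - t E x\<close> the form is at most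
    \<open>q |x|^2 - 2 t |E x|^2 + t^2 q |E x|^2\<close>; \<open>t = 1/q\<close> minimises this
    bound, and its nonnegativity is the norm estimate.\<close>
  have "0 \<le> (x - (1/q) *\<^sub>R ?y) \<bullet> E (x - (1/q) *\<^sub>R ?y)"
    by (rule form)
  also have "\<dots> = x \<bullet> ?y - 2 / q * (?y \<bullet> ?y) + (1/q)^2 * (?y \<bullet> E ?y)"
    using sym[of x ?y]
    by (simp add: blinfun.diff_right blinfun.scaleR_right inner_diff inner_commute
        power2_eq_square algebra_simps)
  also have "\<dots> \<le> q * (x \<bullet> x) - 2 / q * (?y \<bullet> ?y) + (1/q)^2 * (q * (?y \<bullet> ?y))"
    using form(2)[of x] mult_left_mono[OF form(2)[of ?y], of "(1/q)^2"] by simp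
  also have "\<dots> = q * (x \<bullet> x) - (?y \<bullet> ?y) / q"
    using q by (simp add: power2_eq_square field_simps)
  finally have "?y \<bullet> ?y \<le> q^2 * (x \<bullet> x)"
    using q by (simp add: field_simps power2_eq_square)
  then have "(norm ?y)^2 \<le> (q * norm x)^2"
    by (simp add: power_mult_distrib power2_norm_eq_inner)
  then show "norm ?y \<le> q * norm x"
    using q by (simp add: power2_le_iff_abs_le)
qed (use q in simp)

text \<open>Writing the operator as \<open>I - E\<close> with \<open>\<parallel>E\<parallel> < 1\<close>, the square root is \<open>I - Y\<close>
  where \<open>Y\<close> is the fixed point of the contraction \<open>Y \<mapsto> (E + Y\<^sup>2) / 2\<close>.\<close>

lemma symmetric_contraction_sqrt:
  fixes E :: "'a::euclidean_space \<Rightarrow>\<^sub>L 'a"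
  assumes sym: "\<And>x y. E x \<bullet> y = x \<bullet> E y" and q: "norm E \<le> q" "q < 1"
  obtains Y :: "'a \<Rightarrow>\<^sub>L 'a" where "norm Y \<le> q" "\<And>x y. Y x \<bullet> y = x \<bullet> Y y" "2 *\<^sub>R Y = E + (Y o\<^sub>L Y)"
proof -
  define s where "s = {Y :: 'a \<Rightarrow>\<^sub>L 'a. norm Y \<le> q \<and> (\<forall>x y. blinfun_apply Y x \<bullet> y = x \<bullet> blinfun_apply Y y)}"
  define f where "f Y = (1/2) *\<^sub>R (E + (Y o\<^sub>L Y))" for Y
  have q0: "0 \<le> q" using q(1) norm_ge_zero[of E] by linarith
  have "closed s"
    unfolding s_def
    by (intro closed_Collect_conj closed_Collect_all closed_Collect_eq closed_Collect_le
        continuous_intros)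
  then have "complete s" by (simp add: complete_eq_closed)
  moreover have "s \<noteq> {}" using sym q by (auto simp: s_def)
  moreover have "f ` s \<subseteq> s"
  proof (rule image_subsetI)
    fix Y :: "'a \<Rightarrow>\<^sub>L 'a" assume "Y \<in> s"
    then have Y: "norm Y \<le> q" "\<And>x y. Y x \<bullet> y = x \<bullet> Y y" by (auto simp: s_def)
    have "norm (E + (Y o\<^sub>L Y)) \<le> q + q * q"
      using norm_triangle_ineq[of E "Y o\<^sub>L Y"] norm_blinfun_compose[of Y Y]
        mult_mono[OF Y(1) Y(1)] q q0 by force
    also have "\<dots> \<le> 2 * q" using q0 q mult_left_mono[of q 1 q] by simp
    finally have "norm (f Y) \<le> q" by (simp add: f_def)
    then show "f Y \<in> s"
      using Y(2) sym by (auto simp: s_def f_def plus_blinfun.rep_eq scaleR_blinfun.rep_eq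
          blinfun.bilinear_simps inner_add_left inner_add_right)
  qed
  moreover have "\<forall>x\<in>s. \<forall>y\<in>s. dist (f x) (f y) \<le> q * dist x y"
  proof (intro ballI)
    fix Y Z :: "'a \<Rightarrow>\<^sub>L 'a" assume "Y \<in> s" "Z \<in> s"
    then have YZ: "norm Y \<le> q" "norm Z \<le> q" by (auto simp: s_def)
    \<comment> \<open>\<open>Y\<close> and \<open>Z\<close> need not commute, so the difference of
      squares is split by inserting the mixed product \<open>Y Z\<close>.\<close>
    have "(Y o\<^sub>L Y) - (Z o\<^sub>L Z) = (Y o\<^sub>L (Y - Z)) + ((Y - Z) o\<^sub>L Z)"
      by (rule blinfun_eqI) (simp add: blinfun.bilinear_simps)
    then have "norm ((Y o\<^sub>L Y) - (Z o\<^sub>L Z)) \<le> norm Y * norm (Y - Z) + norm (Y - Z) * norm Z"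
      using norm_triangle_ineq[of "Y o\<^sub>L (Y - Z)" "(Y - Z) o\<^sub>L Z"]
        norm_blinfun_compose[of Y "Y - Z"] norm_blinfun_compose[of "Y - Z" Z] by simp
    also have "\<dots> \<le> q * norm (Y - Z) + norm (Y - Z) * q"
      using YZ q0 by (intro add_mono mult_mono) auto
    finally have "norm ((Y o\<^sub>L Y) - (Z o\<^sub>L Z)) \<le> 2 * (q * norm (Y - Z))" by simp
    moreover have "f Y - f Z = (1/2) *\<^sub>R ((Y o\<^sub>L Y) - (Z o\<^sub>L Z))"
      by (simp add: f_def algebra_simps)
    ultimately show "dist (f Y) (f Z) \<le> q * dist Y Z"
      by (simp add: dist_norm)
  qed
  ultimately obtain Y where Y: "Y \<in> s" "f Y = Y"
    using Banach_fix[of s q f] q q0 by blast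
  show ?thesis
  proof (rule that[of Y])
    have "2 *\<^sub>R Y = 2 *\<^sub>R f Y" using Y by simp
    also have "\<dots> = E + (Y o\<^sub>L Y)" by (simp add: f_def)
    finally show "2 *\<^sub>R Y = E + (Y o\<^sub>L Y)" .
  qed (use Y(1) in \<open>auto simp: s_def\<close>)
qed

section \<open>Symmetric positive definite matrices and their roots\<close>

lemma sym_mat_inner: "sym_mat B \<Longrightarrow> (B *v x) \<bullet> y = x \<bullet> (B *v y)"
  by (metis dot_lmul_matrix inner_commute sym_mat_def vector_transpose_matrix)

lemma sym_matI: "(\<And>x y. (B *v x) \<bullet> y = x \<bullet> (B *v y)) \<Longrightarrow> sym_mat B"
  unfolding sym_mat_def
  by (metis dot_lmul_matrix inner_commute matrix_vector_mul_assoc matrix_eq vector_eq_ldot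
      vector_transpose_matrix transpose_matrix_vector)

text \<open>The two bounds on the quadratic form stand in for bounds on the spectrum: the lower one
  yields invertibility, the upper one the scaling under which \<open>I - B / C\<close> has norm
  below 1.\<close>

definition spd_mat :: "real^'n^'n \<Rightarrow> bool" where
  "spd_mat B \<longleftrightarrow> sym_mat B \<and>
     (\<exists>c C. 0 < c \<and> (\<forall>v. c * (v \<bullet> v) \<le> v \<bullet> (B *v v) \<and> v \<bullet> (B *v v) \<le> C * (v \<bullet> v)))"

lemma spd_mat_sqrt_exists:
  fixes B :: "real^'n^'n"
  assumes "spd_mat B"
  obtains R where "spd_mat R" "R ** R = B"
proof -
  from assms obtain c C0 where sB: "sym_mat B" and c: "0 < c"
    and lo: "\<And>v. c * (v \<bullet> v) \<le> v \<bullet> (B *v v)" and up0: "\<And>v. v \<bullet> (B *v v) \<le> C0 * (v \<bullet> v)"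
    unfolding spd_mat_def by blast
  \<comment> \<open>This choice gives \<open>0 < c < C\<close> whatever the sign of
    \<open>C0\<close>, so that \<open>q = 1 - c / C\<close> lies strictly between 0 and 1.\<close>
  define C where "C = \<bar>C0\<bar> + 2 * c"
  define q where "q = 1 - c / C"
  have C: "0 < C" "c < C" using c by (auto simp: C_def)
  have q: "0 < q" "q < 1" using c C by (auto simp: q_def)
  have up: "v \<bullet> (B *v v) \<le> C * (v \<bullet> v)" for v
  proof -
    have "C0 * (v \<bullet> v) \<le> C * (v \<bullet> v)" using c by (intro mult_right_mono) (auto simp: C_def)
    then show ?thesis using up0[of v] by linarith
  qed
  have bl: "bounded_linear (\<lambda>v. v - (1/C) *\<^sub>R (B *v v))"
    by (intro bounded_linear_sub bounded_linear_ident bounded_linear_compose[OF bounded_linear_scaleR_right]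
        matrix_vector_mul_bounded_linear)
  define E where "E = Blinfun (\<lambda>v. v - (1/C) *\<^sub>R (B *v v))"
  have E: "blinfun_apply E v = v - (1/C) *\<^sub>R (B *v v)" for v
    using bounded_linear_Blinfun_apply[OF bl] by (simp add: E_def)
  have Esym: "E x \<bullet> y = x \<bullet> E y" for x y
    using sym_mat_inner[OF sB, of x y] by (simp add: E inner_diff)
  have Ef: "x \<bullet> E x = x \<bullet> x - (x \<bullet> (B *v x)) / C" for x
    by (simp add: E inner_diff_right)
  have "norm E \<le> q"
  proof (rule symmetric_blinfun_norm_bound[OF Esym q(1)])
    fix x show "0 \<le> x \<bullet> E x"
      using up[of x] C by (simp add: Ef field_simps)
    show "x \<bullet> E x \<le> q * (x \<bullet> x)"
      using lo[of x] C by (simp add: Ef q_def field_simps)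
  qed
  from symmetric_contraction_sqrt[OF Esym this q(2)] obtain Y :: "(real^'n) \<Rightarrow>\<^sub>L (real^'n)" where
    Y: "norm Y \<le> q" "\<And>x y. Y x \<bullet> y = x \<bullet> Y y" "2 *\<^sub>R Y = E + (Y o\<^sub>L Y)" by blast
  have blR: "bounded_linear (\<lambda>v. sqrt C *\<^sub>R (v - Y v))"
    by (intro bounded_linear_compose[OF bounded_linear_scaleR_right] bounded_linear_sub
        bounded_linear_ident blinfun.bounded_linear_right)
  \<comment> \<open>\<open>(I - Y)^2 = I - 2 Y + Y^2 = I - E = B / C\<close>, hence the factor
    \<open>sqrt C\<close>.\<close>
  define R where "R = matrix (\<lambda>v. sqrt C *\<^sub>R (v - Y v))"
  have R: "R *v v = sqrt C *\<^sub>R (v - Y v)" for v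
    unfolding R_def using blR by (simp add: matrix_works bounded_linear.linear)
  have "R ** R = B"
  proof (subst matrix_eq, rule allI)
    fix x
    have *: "2 *\<^sub>R Y x = E x + Y (Y x)"
      using arg_cong[OF Y(3), of "\<lambda>F. blinfun_apply F x"]
      by (simp add: plus_blinfun.rep_eq scaleR_blinfun.rep_eq)
    have "(R ** R) *v x = C *\<^sub>R (x - Y x - Y (x - Y x))"
      using C by (simp add: R matrix_vector_mul_assoc[symmetric] blinfun.bilinear_simps
          scaleR_diff_right[symmetric])
    also have "x - Y x - Y (x - Y x) = x - 2 *\<^sub>R Y x + Y (Y x)"
      by (simp add: blinfun.bilinear_simps scaleR_2)
    also have "\<dots> = x - E x" unfolding * by simp
    also have "C *\<^sub>R \<dots> = B *v x" using C by (simp add: E)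
    finally show "(R ** R) *v x = B *v x" .
  qed
  moreover have "spd_mat R"
    unfolding spd_mat_def
  proof (intro conjI exI allI)
    show "sym_mat R"
      by (rule sym_matI) (simp add: R inner_diff Y(2))
    show "0 < sqrt C * (1 - q)" using C q by simp
    fix v
    have "\<bar>v \<bullet> Y v\<bar> \<le> norm v * (norm Y * norm v)"
      using Cauchy_Schwarz_ineq2[of v "Y v"] norm_blinfun[of Y v]
        mult_left_mono[OF norm_blinfun[of Y v], of "norm v"] by simp
    also have "\<dots> \<le> norm v * (q * norm v)"
      using Y(1) by (intro mult_left_mono mult_right_mono) auto
    also have "\<dots> = q * (v \<bullet> v)" by (simp add: dot_square_norm power2_eq_square)
    finally have *: "\<bar>v \<bullet> Y v\<bar> \<le> q * (v \<bullet> v)" .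
    have "v \<bullet> (R *v v) = sqrt C * (v \<bullet> v - v \<bullet> Y v)" by (simp add: R inner_diff_right)
    moreover have "(1 - q) * (v \<bullet> v) \<le> v \<bullet> v - v \<bullet> Y v"
      "v \<bullet> v - v \<bullet> Y v \<le> (1 + q) * (v \<bullet> v)"
      using * by (auto simp: algebra_simps)
    then have "sqrt C * ((1 - q) * (v \<bullet> v)) \<le> sqrt C * (v \<bullet> v - v \<bullet> Y v)"
      "sqrt C * (v \<bullet> v - v \<bullet> Y v) \<le> sqrt C * ((1 + q) * (v \<bullet> v))"
      using C by (auto intro: mult_left_mono)
    ultimately show "sqrt C * (1 - q) * (v \<bullet> v) \<le> v \<bullet> (R *v v)"
      "v \<bullet> (R *v v) \<le> sqrt C * (1 + q) * (v \<bullet> v)"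
      by (auto simp: mult.assoc)
  qed
  ultimately show ?thesis using that by blast
qed

lemma spd_mat_invertible:
  assumes "spd_mat B" shows "invertible B"
proof -
  from assms obtain c where c: "0 < c" "\<And>v. c * (v \<bullet> v) \<le> v \<bullet> (B *v v)"
    unfolding spd_mat_def by blast
  have "x = 0" if "B *v x = 0" for x
  proof -
    have "c * (x \<bullet> x) \<le> 0" using c(2)[of x] that by simp
    then show ?thesis using c(1)
      by (metis inner_eq_zero_iff inner_ge_zero mult_le_0_iff not_less order_antisym)
  qed
  then show ?thesis
    unfolding invertible_left_inverse using matrix_left_invertible_ker[of B] by blast
qed

text \<open>A square root makes the determinant a square, so invertibility already forces it to be
  positive; no eigenvalues are needed.\<close>

lemma spd_mat_det_pos:
  fixes B :: "real^'n^'n"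
  assumes "spd_mat B" shows "0 < det B"
proof -
  obtain S where S: "S ** S = B" using spd_mat_sqrt_exists[OF assms] by blast
  have "det B = det S * det S" using S by (metis det_mul)
  moreover have "det B \<noteq> 0"
    using spd_mat_invertible[OF assms] by (simp add: invertible_det_nz)
  ultimately show ?thesis by (metis mult_zero_left not_real_square_gt_zero)
qed

text \<open>A trace becomes a sum of values of the quadratic form of \<open>P\<close> at the columns
  of \<open>X\<close>, so a sign of the form can be used term by term.\<close>

lemma trace_sym_conj:
  fixes X P :: "real^'n^'n"
  assumes "sym_mat X"
  shows "trace (X ** (P ** X)) = (\<Sum>i\<in>UNIV. (X *v axis i 1) \<bullet> (P *v (X *v axis i 1)))"
proof -
  have "(X ** (P ** X)) $ i $ i = (X *v axis i 1) \<bullet> (P *v (X *v axis i 1))" for i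
  proof -
    have "(X ** (P ** X)) $ i $ i = axis i 1 \<bullet> ((X ** (P ** X)) *v axis i 1)"
      by (simp add: inner_axis' matrix_vector_mul_component inner_axis)
    also have "\<dots> = axis i 1 \<bullet> (X *v (P *v (X *v axis i 1)))"
      by (simp add: matrix_vector_mul_assoc)
    finally show ?thesis using sym_mat_inner[OF assms] by simp
  qed
  then show ?thesis by (simp add: trace_def)
qed

text \<open>For two square roots \<open>R, T\<close> and \<open>X = R - T\<close>, the identity \<open>R X + X T = 0\<close> gives
  \<open>tr (X (R + T) X) = 0\<close>.\<close>

lemma spd_mat_sqrt_unique:
  fixes R T :: "real^'n^'n"
  assumes R: "sym_mat R" "psd_mat R" and T: "spd_mat T" and eq: "R ** R = T ** T"
  shows "R = T"
proof -
  define X where "X = R - T"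
  from T obtain c where c: "0 < c" "\<And>v. c * (v \<bullet> v) \<le> v \<bullet> (T *v v)" and sT: "sym_mat T"
    unfolding spd_mat_def by blast
  have sX: "sym_mat X"
    using R(1) sT sym_mat_inner[of R] sym_mat_inner[of T]
    by (intro sym_matI) (simp add: X_def matrix_vector_mult_diff_rdistrib inner_diff)
  have 0: "R ** X + X ** T = 0"
    using eq
    by (simp add: matrix_eq X_def matrix_vector_mult_add_rdistrib matrix_vector_mult_diff_rdistrib
        matrix_vector_mult_diff_distrib flip: matrix_vector_mul_assoc)
  \<comment> \<open>Cyclicity turns the trace of \<open>X T X\<close> into that of
    \<open>X X T\<close>, which makes the factor \<open>R X + X T\<close> appear.\<close>
  have "trace (X ** (R ** X)) + trace (X ** (T ** X)) = trace (X ** (R ** X)) + trace (X ** (X ** T))"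
    by (simp add: trace_mul_sym[of X "X ** T"]) (simp add: matrix_mul_assoc)
  also have "\<dots> = trace (X ** (R ** X + X ** T))"
    by (simp add: trace_add matrix_add_ldistrib)
  also have "\<dots> = 0" by (simp add: 0 trace_def)
  finally have "(\<Sum>i\<in>UNIV. (X *v axis i 1) \<bullet> (R *v (X *v axis i 1))
      + (X *v axis i 1) \<bullet> (T *v (X *v axis i 1))) = 0"
    by (simp add: trace_sym_conj[OF sX] sum.distrib)
  moreover have Rn: "0 \<le> v \<bullet> (R *v v)" and Tn: "0 \<le> v \<bullet> (T *v v)" for v
    using R(2) c(2)[of v] mult_nonneg_nonneg[of c "v \<bullet> v"] c(1)
    by (auto simp: psd_mat_def intro: order_trans[rotated])
  ultimately have z: "(X *v axis i 1) \<bullet> (R *v (X *v axis i 1))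
      + (X *v axis i 1) \<bullet> (T *v (X *v axis i 1)) = 0" for i
    by (subst (asm) sum_nonneg_eq_0_iff) (auto intro: add_nonneg_nonneg)
  have "X *v axis i 1 = 0" for i
  proof -
    let ?v = "X *v axis i 1"
    \<comment> \<open>The form of \<open>R\<close> contributes only its sign; the coercivity of
      \<open>T\<close> alone forces the column to vanish.\<close>
    have "c * (?v \<bullet> ?v) \<le> 0" using c(2)[of ?v] z[of i] Rn[of ?v] by linarith
    then show ?thesis using c(1)
      by (metis inner_eq_zero_iff inner_ge_zero mult_le_0_iff not_less order_antisym)
  qed
  then have "X = 0"
    by (simp add: vec_eq_iff matrix_vector_mul_component inner_axis)
  then show ?thesis by (simp add: X_def)
qed

text \<open>The description in \<open>mat_sqrt\<close> ranges over all positive semidefinite roots,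
  so the coercive root constructed above has to be unique among those, not merely among coercive
  ones.\<close>

lemma spd_mat_mat_sqrt:
  fixes B :: "real^'n^'n"
  assumes "spd_mat B" shows "spd_mat (mat_sqrt B)"
proof -
  obtain T where T: "spd_mat T" "T ** T = B" using spd_mat_sqrt_exists[OF assms] by blast
  have psd: "psd_mat T"
    using T(1) unfolding spd_mat_def psd_mat_def
    by (meson inner_ge_zero less_imp_le mult_nonneg_nonneg order_trans)
  have "mat_sqrt B = T"
    unfolding mat_sqrt_def
  proof (rule the_equality)
    show "sym_mat T \<and> psd_mat T \<and> T ** T = B"
      using T psd by (auto simp: spd_mat_def)
  qed (use spd_mat_sqrt_unique[of _ T] T in simp)
  then show ?thesis using T by simp
qed

text \<open>Subtracting half of the ellipticity constant leaves the other half as a lower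
  bound.\<close>

lemma spd_mat_Mcoef:
  fixes A :: "real^'n \<Rightarrow> real^'n^'n"
  assumes "sym_mat (A x)" "0 < lam"
    and "\<And>v. lam * (v \<bullet> v) \<le> v \<bullet> (A x *v v)" "\<And>v. v \<bullet> (A x *v v) \<le> Lam * (v \<bullet> v)"
  shows "spd_mat (Mcoef lam A x)"
  unfolding Mcoef_def
proof (rule spd_mat_mat_sqrt)
  let ?B = "A x - (lam / 2) *\<^sub>R mat 1"
  have B: "?B *v v = A x *v v - (lam / 2) *\<^sub>R v" for v
    by (simp only: matrix_vector_mult_diff_rdistrib scaleR_matrix_vector_assoc[symmetric] matrix_vector_mul_lid)
  have "sym_mat ?B"
    using sym_mat_inner[OF assms(1)] by (intro sym_matI) (simp add: B inner_diff)
  moreover have "lam / 2 * (v \<bullet> v) \<le> v \<bullet> (?B *v v) \<and> v \<bullet> (?B *v v) \<le> (Lam - lam / 2) * (v \<bullet> v)" for v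
    using assms(3,4)[of v] unfolding B inner_diff_right by (simp add: algebra_simps)
  ultimately show "spd_mat ?B"
    unfolding spd_mat_def using assms(2) half_gt_zero by blast
qed

section \<open>Barycentric gradients on a simplex\<close>

lemma simplex_affine_hull: "is_simplex (S :: (real^'n) set) \<Longrightarrow> affine hull S = UNIV"
  by (rule affine_independent_span_eq) (auto simp: is_simplex_def)

lemma simplex_interior_nonempty:
  "is_simplex (S :: (real^'n) set) \<Longrightarrow> interior (convex hull S) \<noteq> {}"
  using interior_convex_hull_eq_empty[of S] by (simp add: is_simplex_def)

lemma simplex_interpolation:
  fixes S :: "(real^'n) set" and c :: "real^'n \<Rightarrow> real"
  assumes "is_simplex S"
  obtains a b where "\<And>v. v \<in> S \<Longrightarrow> a \<bullet> v + b = c v"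
proof -
  have S: "card S = CARD('n) + 1" "\<not> affine_dependent S" using assms by (auto simp: is_simplex_def)
  then obtain p where p: "p \<in> S" by fastforce
  have "independent ((\<lambda>x. - p + x) ` (S - {p}))"
    using S(2) affine_dependent_iff_dependent2[OF p] by simp
  then obtain g :: "real^'n \<Rightarrow> real" where g: "linear g"
    "\<forall>x\<in>(\<lambda>x. - p + x) ` (S - {p}). g x = c (p + x) - c p"
    using linear_independent_extend[of _ "\<lambda>x. c (p + x) - c p"] by blast
  \<comment> \<open>\<open>adjoint g 1\<close> is the Riesz vector of the functional
    \<open>g\<close>.\<close>
  have gi: "g x = adjoint g 1 \<bullet> x" for x
    using adjoint_works[OF g(1), of x 1] by (simp add: inner_commute)
  have "adjoint g 1 \<bullet> v + (c p - g p) = c v" if v: "v \<in> S" for v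
  proof (cases "v = p")
    case True then show ?thesis by (simp add: gi)
  next
    case False
    then have "g (- p + v) = c v - c p" using g(2) v by auto
    then show ?thesis by (simp add: gi inner_diff_right)
  qed
  then show ?thesis using that by blast
qed

lemma affine_fun_eq_on_convex_hull:
  fixes a a' :: "'a::euclidean_space"
  assumes "\<And>v. v \<in> S \<Longrightarrow> a \<bullet> v + b = a' \<bullet> v + b'" "x \<in> convex hull S"
  shows "a \<bullet> x + b = a' \<bullet> x + b'"
proof -
  have "convex hull S \<subseteq> {x. (a - a') \<bullet> x = b' - b}"
    using assms(1) by (intro hull_minimal convex_hyperplane) (auto simp: inner_diff_left algebra_simps)
  then show ?thesis using assms(2) by (auto simp: inner_diff_left algebra_simps)
qed

lemma affine_fun_le_on_convex_hull:
  fixes a :: "'a::euclidean_space"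
  assumes "\<And>v. v \<in> S \<Longrightarrow> a \<bullet> v + b \<le> m" "x \<in> convex hull S"
  shows "a \<bullet> x + b \<le> m"
proof -
  have "convex hull S \<subseteq> {x. a \<bullet> x \<le> m - b}"
    using assms(1) by (intro hull_minimal convex_halfspace_le) (auto simp: algebra_simps)
  then show ?thesis using assms(2) by (auto simp: algebra_simps)
qed

lemma affine_fun_less_on_convex_hull:
  fixes a :: "'a::euclidean_space"
  assumes "\<And>v. v \<in> S \<Longrightarrow> a \<bullet> v + b < m" "x \<in> convex hull S"
  shows "a \<bullet> x + b < m"
proof -
  have "convex hull S \<subseteq> {x. a \<bullet> x < m - b}"
    using assms(1) by (intro hull_minimal convex_halfspace_lt) (auto simp: algebra_simps)
  then show ?thesis using assms(2) by (auto simp: algebra_simps)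
qed

lemma affine_fun_unique:
  fixes a a' :: "'a::euclidean_space"
  assumes "affine hull S = UNIV" "\<And>v. v \<in> S \<Longrightarrow> a \<bullet> v + b = a' \<bullet> v + b'"
  shows "a = a'" "b = b'"
proof -
  have "affine hull S \<subseteq> {x. (a - a') \<bullet> x = b' - b}"
    using assms(2) by (intro hull_minimal affine_hyperplane) (auto simp: inner_diff_left algebra_simps)
  then have *: "(a - a') \<bullet> x = b' - b" for x using assms(1) by auto
  from *[of 0] show "b = b'" by simp
  with *[of "a - a'"] show "a = a'" by simp
qed

text \<open>The constant gradient on the simplex \<open>S\<close> of the barycentric coordinate of the vertex \<open>v\<close>.\<close>

definition bary_grad :: "(real^'n) set \<Rightarrow> real^'n \<Rightarrow> real^'n" where
  "bary_grad S v = (SOME a. \<exists>b. \<forall>p\<in>S. a \<bullet> p + b = of_bool (p = v))"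

lemma bary_grad:
  assumes "is_simplex S"
  obtains b where "\<And>p. p \<in> S \<Longrightarrow> bary_grad S v \<bullet> p + b = of_bool (p = v)"
proof -
  have "\<exists>a b. \<forall>p\<in>S. a \<bullet> p + b = of_bool (p = v)"
    using simplex_interpolation[OF assms, of "\<lambda>p. of_bool (p = v)"] by metis
  from someI_ex[OF this] show ?thesis using that unfolding bary_grad_def by blast
qed

lemma bary_grad_diff:
  assumes "is_simplex S" "p \<in> S" "q \<in> S"
  shows "bary_grad S v \<bullet> (p - q) = of_bool (p = v) - of_bool (q = v)"
proof -
  obtain b where "\<And>p. p \<in> S \<Longrightarrow> bary_grad S v \<bullet> p + b = of_bool (p = v)"
    using bary_grad[OF assms(1)] by blast
  from this[OF assms(2)] this[OF assms(3)] show ?thesis by (simp add: inner_diff_right)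
qed

text \<open>The barycentric coordinates weighted by \<open>c\<close> reproduce the affine function
  at the vertices; these affinely span the space, so the gradients agree.\<close>

lemma affine_fun_grad_expansion:
  assumes S: "is_simplex S" and ab: "\<And>p. p \<in> S \<Longrightarrow> a \<bullet> p + b = c p"
  shows "a = (\<Sum>v\<in>S. c v *\<^sub>R bary_grad S v)"
proof -
  have fin: "finite S" using S by (simp add: is_simplex_def)
  have "\<exists>b. \<forall>p\<in>S. bary_grad S v \<bullet> p + b = of_bool (p = v)" for v
    using bary_grad[OF S] by metis
  then obtain B where B: "\<And>v p. p \<in> S \<Longrightarrow> bary_grad S v \<bullet> p + B v = of_bool (p = v)" by metis
  have "(\<Sum>v\<in>S. c v *\<^sub>R bary_grad S v) \<bullet> p + (\<Sum>v\<in>S. c v * B v) = a \<bullet> p + b" if p: "p \<in> S" for p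
  proof -
    have "(\<Sum>v\<in>S. c v *\<^sub>R bary_grad S v) \<bullet> p + (\<Sum>v\<in>S. c v * B v)
        = (\<Sum>v\<in>S. c v * (bary_grad S v \<bullet> p + B v))"
      by (simp add: inner_sum_left sum.distrib distrib_left)
    also have "\<dots> = c p" using p fin by (simp add: B of_bool_def if_distrib sum.delta cong: if_cong)
    finally show ?thesis using ab[OF p] by simp
  qed
  from affine_fun_unique(1)[OF simplex_affine_hull[OF S] this] show ?thesis by simp
qed

lemma sum_bary_grad: "is_simplex S \<Longrightarrow> (\<Sum>v\<in>S. bary_grad S v) = 0"
  using affine_fun_grad_expansion[of S 0 1 "\<lambda>_. 1"] by simp

section \<open>Facet normals, acuteness, and maxima at vertices\<close>

lemma bary_grad_nonzero:
  fixes S :: "(real^'n) set"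
  assumes S: "is_simplex S" "v \<in> S" shows "bary_grad S v \<noteq> 0"
proof -
  have "card S > card {v}" using S by (simp add: is_simplex_def)
  then obtain p where "p \<in> S" "p \<noteq> v"
    by (metis card_mono finite.emptyI finite_insert not_less singletonI subsetI)
  then show ?thesis using bary_grad_diff[of S v p v] S by auto
qed

text \<open>Resolves the definite description of the outward normal of the facet opposite
  \<open>v\<close>, so that the angle condition becomes a sign condition on products of barycentric
  gradients.\<close>

lemma facet_normal_eq:
  fixes S :: "(real^'n) set"
  assumes S: "is_simplex S" "v \<in> S"
  shows "facet_normal S v = - (1 / norm (bary_grad S v)) *\<^sub>R bary_grad S v"
  unfolding facet_normal_def
proof (rule the_equality)
  let ?G = "bary_grad S v"
  have G: "?G \<noteq> 0" using bary_grad_nonzero[OF S] .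
  have d: "?G \<bullet> (p - q) = of_bool (p = v) - of_bool (q = v)" if "p \<in> S" "q \<in> S" for p q
    using bary_grad_diff[OF S(1) that] .
  let ?m = "- (1 / norm ?G) *\<^sub>R ?G"
  show "norm ?m = 1 \<and> (\<forall>p\<in>S - {v}. \<forall>q\<in>S - {v}. ?m \<bullet> (p - q) = 0) \<and>
      (\<forall>p\<in>S - {v}. ?m \<bullet> (v - p) < 0)"
    using G d S(2) by simp
  fix n
  assume n: "norm n = 1 \<and> (\<forall>p\<in>S - {v}. \<forall>q\<in>S - {v}. n \<bullet> (p - q) = 0) \<and>
      (\<forall>p\<in>S - {v}. n \<bullet> (v - p) < 0)"
  have "card S > card {v}" using S by (simp add: is_simplex_def)
  then obtain p where p: "p \<in> S" "p \<noteq> v"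
    by (metis card_mono finite.emptyI finite_insert not_less singletonI subsetI)
  \<comment> \<open>As an affine function, \<open>n\<close> takes the value \<open>t\<close> at
    \<open>v\<close> relative to the facet, where it is constant; thus it is \<open>t\<close> times
    the barycentric coordinate, and unit length with \<open>t < 0\<close> fixes
    \<open>t\<close>.\<close>
  define t where "t = n \<bullet> (v - p)"
  have t: "t < 0" using n p by (simp add: t_def)
  obtain b where b: "\<And>q. q \<in> S \<Longrightarrow> ?G \<bullet> q + b = of_bool (q = v)"
    using bary_grad[OF S(1)] by blast
  have "n \<bullet> q + (- (n \<bullet> p)) = (t *\<^sub>R ?G) \<bullet> q + t * b" if q: "q \<in> S" for q
  proof -
    have "(t *\<^sub>R ?G) \<bullet> q + t * b = t * of_bool (q = v)"
      using b[OF q] by (simp add: distrib_left[symmetric])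
    moreover have "n \<bullet> (q - p) = t * of_bool (q = v)"
      using n p q by (auto simp: t_def)
    ultimately show ?thesis by (simp add: inner_diff_right)
  qed
  from affine_fun_unique(1)[OF simplex_affine_hull[OF S(1)] this] have nt: "n = t *\<^sub>R ?G" .
  then have "\<bar>t\<bar> * norm ?G = 1" using n by simp
  then have "t = - (1 / norm ?G)" using t G by (simp add: field_simps)
  then show "n = ?m" using nt by simp
qed

text \<open>An angle of at most \<open>pi / 2\<close> means that \<open>arccos\<close> of the
  product of the normals is at least \<open>pi / 2\<close>, so this product is nonpositive. Both
  normals are negative multiples of the gradients, and the two signs cancel.\<close>

lemma weakly_acute_bary_grad:
  fixes S :: "(real^'n) set"
  assumes "weakly_acute \<T>" "S \<in> \<T>" and S: "is_simplex S" and v: "v \<in> S" and w: "w \<in> S" "v \<noteq> w"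
  shows "bary_grad S v \<bullet> bary_grad S w \<le> 0"
proof -
  let ?c = "facet_normal S v \<bullet> facet_normal S w"
  have G: "bary_grad S v \<noteq> 0" "bary_grad S w \<noteq> 0" using bary_grad_nonzero[OF S] v w by auto
  then have "norm (facet_normal S v) = 1" "norm (facet_normal S w) = 1"
    using facet_normal_eq[OF S v] facet_normal_eq[OF S w(1)] by auto
  then have c: "\<bar>?c\<bar> \<le> 1" using Cauchy_Schwarz_ineq2[of "facet_normal S v" "facet_normal S w"] by simp
  have "pi / 2 \<le> arccos ?c"
    using assms unfolding weakly_acute_def dihedral_angle_def by fastforce
  then have "cos (arccos ?c) \<le> cos (pi / 2)"
    using arccos_bounded[of ?c] c by (intro cos_monotone_0_pi_le) auto
  then have "?c \<le> 0" using c by simp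
  moreover have "bary_grad S v \<bullet> bary_grad S w = norm (bary_grad S v) * norm (bary_grad S w) * ?c"
    using G facet_normal_eq[OF S v] facet_normal_eq[OF S w(1)] by simp
  ultimately show ?thesis by (simp add: mult_nonneg_nonpos)
qed

text \<open>The barycentric gradients sum to zero, so \<open>m\<close> may be subtracted from every
  coefficient. All coefficients are then nonpositive, and the one at a maximal vertex
  \<open>z\<close> vanishes, which removes the only positive product with
  \<open>bary_grad S z\<close>.\<close>

lemma grad_at_max_vertex:
  assumes S: "is_simplex S" and acute: "\<And>v w. v \<in> S \<Longrightarrow> w \<in> S \<Longrightarrow> v \<noteq> w \<Longrightarrow> bary_grad S v \<bullet> bary_grad S w \<le> 0"
    and ab: "\<And>p. p \<in> S \<Longrightarrow> a \<bullet> p + b = c p" and le: "\<And>p. p \<in> S \<Longrightarrow> c p \<le> m"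
  shows "a = (\<Sum>v\<in>S. (c v - m) *\<^sub>R bary_grad S v)"
    and "z \<in> S \<Longrightarrow> c z = m \<Longrightarrow> 0 \<le> a \<bullet> bary_grad S z"
proof -
  show a: "a = (\<Sum>v\<in>S. (c v - m) *\<^sub>R bary_grad S v)"
    using affine_fun_grad_expansion[OF S, of a b c] sum_bary_grad[OF S] ab
    by (simp add: scaleR_diff_left sum_subtractf flip: scaleR_sum_right)
  show "0 \<le> a \<bullet> bary_grad S z" if z: "z \<in> S" "c z = m"
    unfolding a inner_sum_left
  proof (rule sum_nonneg)
    fix v assume v: "v \<in> S"
    show "0 \<le> (c v - m) *\<^sub>R bary_grad S v \<bullet> bary_grad S z"
      using z le[OF v] acute[OF v z(1)] by (cases "v = z") (auto simp: mult_nonpos_nonpos)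
  qed
qed

text \<open>Let \<open>D\<close> be the set of vertices where the maximum is attained and
  \<open>g\<close> the sum of the barycentric gradients over \<open>D\<close>. If the
  gradient is orthogonal to \<open>g\<close>, then so are all barycentric gradients of the other vertices,
  hence \<open>g \<bullet> g = 0\<close>; but \<open>g\<close> is the gradient of a function that is \<open>1\<close> on \<open>D\<close> and \<open>0\<close>
  at the other vertices.\<close>

lemma max_vertex_orthogonal_imp_constant:
  assumes S: "is_simplex S" and acute: "\<And>v w. v \<in> S \<Longrightarrow> w \<in> S \<Longrightarrow> v \<noteq> w \<Longrightarrow> bary_grad S v \<bullet> bary_grad S w \<le> 0"
    and ab: "\<And>p. p \<in> S \<Longrightarrow> a \<bullet> p + b = c p" and le: "\<And>p. p \<in> S \<Longrightarrow> c p \<le> m"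
    and orth: "\<And>z. z \<in> S \<Longrightarrow> c z = m \<Longrightarrow> a \<bullet> bary_grad S z = 0"
    and z: "z \<in> S" "c z = m" and v: "v \<in> S"
  shows "c v = m"
proof (rule ccontr)
  assume vm: "c v \<noteq> m"
  define D where "D = {p\<in>S. c p = m}"
  define g where "g = (\<Sum>p\<in>D. bary_grad S p)"
  have fin: "finite S" using S by (simp add: is_simplex_def)
  have DS: "D \<subseteq> S" by (auto simp: D_def)
  have np: "bary_grad S p \<bullet> g \<le> 0" if "p \<in> S - D" for p
    unfolding g_def inner_sum_right using that DS by (intro sum_nonpos acute) auto
  have "0 = a \<bullet> g" by (simp add: g_def inner_sum_right orth D_def)
  \<comment> \<open>With the shifted coefficients the terms in \<open>D\<close> vanish, and each
    remaining term is a product of two nonpositive factors, the first of them nonzero.\<close>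
  also have "\<dots> = (\<Sum>p\<in>S. (c p - m) * (bary_grad S p \<bullet> g))"
    by (subst grad_at_max_vertex(1)[OF S acute ab le]) (auto simp: inner_sum_left)
  also have "\<dots> = (\<Sum>p\<in>S - D. (c p - m) * (bary_grad S p \<bullet> g))"
    using fin by (intro sum.mono_neutral_right) (auto simp: D_def)
  finally have "(\<Sum>p\<in>S - D. (c p - m) * (bary_grad S p \<bullet> g)) = 0" by simp
  then have "\<forall>p\<in>S - D. (c p - m) * (bary_grad S p \<bullet> g) = 0"
    using fin le np by (subst (asm) sum_nonneg_eq_0_iff) (auto intro!: mult_nonpos_nonpos)
  then have g0: "bary_grad S p \<bullet> g = 0" if "p \<in> S - D" for p using that by (auto simp: D_def)
  have "g + (\<Sum>p\<in>S - D. bary_grad S p) = 0"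
    unfolding g_def using sum_bary_grad[OF S] sum.subset_diff[OF DS fin, of "bary_grad S"]
    by (simp add: add.commute)
  then have "g = - (\<Sum>p\<in>S - D. bary_grad S p)" by (simp add: eq_neg_iff_add_eq_0)
  then have "g \<bullet> g = - (\<Sum>p\<in>S - D. bary_grad S p) \<bullet> g" by simp
  also have "\<dots> = 0" by (simp add: inner_sum_left g0)
  finally have "g = 0" by simp
  have "g \<bullet> (z - v) = (\<Sum>p\<in>D. of_bool (z = p) - of_bool (v = p))"
    by (simp add: g_def inner_sum_left bary_grad_diff[OF S z(1) v])
  also have "\<dots> = (\<Sum>p\<in>D. of_bool (z = p))"
    using vm by (intro sum.cong) (auto simp: D_def)
  also have "\<dots> = 1"
    using z finite_subset[OF DS fin] by (simp add: of_bool_def D_def)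
  finally show False using \<open>g = 0\<close> by simp
qed

section \<open>Piecewise linear functions on a mesh\<close>

lemma integrable_lebesgue_continuous_bounded_support:
  fixes g :: "'a::euclidean_space \<Rightarrow> real"
  assumes "continuous_on UNIV g" "bounded K" "\<And>x. x \<notin> K \<Longrightarrow> g x = 0"
  shows "integrable lebesgue g"
proof -
  have "(\<lambda>x. indicator (closure K) x *\<^sub>R g x) = g"
    using assms(3) closure_subset[of K] by (intro ext) (auto simp: indicator_def)
  moreover have "integrable lborel (\<lambda>x. indicator (closure K) x *\<^sub>R g x)"
    using assms by (intro borel_integrable_compact) (auto intro: continuous_on_subset)
  ultimately have "integrable lborel g" by simp
  then show ?thesis
    using integrable_completion[of g lborel] borel_measurable_integrable by blast
qed

text \<open>Defined through nodal values rather than by choosing a gradient, hence linear in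
  \<open>u\<close> for arbitrary functions.\<close>

definition simplex_grad :: "(real^'n) set \<Rightarrow> (real^'n \<Rightarrow> real) \<Rightarrow> real^'n" where
  "simplex_grad S u = (\<Sum>v\<in>S. u v *\<^sub>R bary_grad S v)"

lemma simplex_grad_diff: "simplex_grad S (\<lambda>x. u x - v x) = simplex_grad S u - simplex_grad S v"
  by (simp add: simplex_grad_def scaleR_diff_left sum_subtractf)

lemma V0_diff: "u \<in> V0 \<T> \<Omega> \<Longrightarrow> v \<in> V0 \<T> \<Omega> \<Longrightarrow> (\<lambda>x. u x - v x) \<in> V0 \<T> \<Omega>"
proof -
  assume u: "u \<in> V0 \<T> \<Omega>" and v: "v \<in> V0 \<T> \<Omega>"
  have "\<exists>a b. \<forall>x\<in>convex hull S. u x - v x = a \<bullet> x + b" if "S \<in> \<T>" for S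
  proof -
    from u v that obtain a b a' b' where "\<forall>x\<in>convex hull S. u x = a \<bullet> x + b"
      "\<forall>x\<in>convex hull S. v x = a' \<bullet> x + b'" unfolding V0_def by blast
    then have "\<forall>x\<in>convex hull S. u x - v x = (a - a') \<bullet> x + (b - b')"
      by (simp add: inner_diff_left)
    then show ?thesis by blast
  qed
  then show ?thesis using u v by (auto simp: V0_def intro: continuous_on_diff)
qed

locale convex_mesh =
  fixes \<T> :: "(real^'n) set set" and \<Omega> :: "(real^'n) set"
  assumes open_dom: "open \<Omega>" and bounded_dom: "bounded \<Omega>" and convex_dom: "convex \<Omega>"
    and simplicial: "simplicial_mesh \<T> \<Omega>"
begin

lemma finite_mesh: "finite \<T>"
  and simplex: "S \<in> \<T> \<Longrightarrow> is_simplex S"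
  and finite_simplex: "S \<in> \<T> \<Longrightarrow> finite S"
  and cover: "(\<Union>S\<in>\<T>. convex hull S) = closure \<Omega>"
  and conforming: "S \<in> \<T> \<Longrightarrow> S' \<in> \<T> \<Longrightarrow> convex hull S \<inter> convex hull S' = convex hull (S \<inter> S')"
  using simplicial by (auto simp: simplicial_mesh_def is_simplex_def)

text \<open>The mesh only covers the closure; convexity excludes slits that would be filled in by
  it, so open elements stay inside the domain.\<close>

lemma interior_closure_dom: "interior (closure \<Omega>) = \<Omega>"
  using convex_interior_closure[OF convex_dom] open_dom by (simp add: interior_open)

lemma hull_subset_closure: "S \<in> \<T> \<Longrightarrow> convex hull S \<subseteq> closure \<Omega>"
  using cover by blast

lemma interior_hull_subset: "S \<in> \<T> \<Longrightarrow> interior (convex hull S) \<subseteq> \<Omega>"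
  using interior_mono[OF hull_subset_closure] interior_closure_dom by blast

text \<open>Two closed pieces overlap on the boundary, where both give zero. Continuity on the whole
  space is what the integrals reaching outside the domain require.\<close>

lemma V0_continuous:
  assumes "u \<in> V0 \<T> \<Omega>" shows "continuous_on UNIV u"
proof -
  have "continuous_on (- \<Omega>) u"
    using assms continuous_on_cong[of "- \<Omega>" "- \<Omega>" u "\<lambda>_. 0"] by (auto simp: V0_def)
  then have "continuous_on (closure \<Omega> \<union> - \<Omega>) u"
    using assms open_dom by (intro continuous_on_closed_Un) (auto simp: V0_def)
  moreover have "closure \<Omega> \<union> - \<Omega> = UNIV" using closure_subset by auto
  ultimately show ?thesis by simp
qed

lemma V0_outside: "u \<in> V0 \<T> \<Omega> \<Longrightarrow> x \<notin> \<Omega> \<Longrightarrow> u x = 0"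
  by (simp add: V0_def)

lemma V0_simplex:
  assumes "u \<in> V0 \<T> \<Omega>" "S \<in> \<T>"
  obtains b where "\<And>x. x \<in> convex hull S \<Longrightarrow> u x = simplex_grad S u \<bullet> x + b"
proof -
  from assms obtain a b where ab: "\<And>x. x \<in> convex hull S \<Longrightarrow> u x = a \<bullet> x + b"
    unfolding V0_def by blast
  then have "a = simplex_grad S u"
    unfolding simplex_grad_def
    by (intro affine_fun_grad_expansion[OF simplex[OF assms(2)]]) (auto simp: hull_inc)
  then show ?thesis using that ab by blast
qed

text \<open>A convex combination giving positive weight to a point of the open convex set, with the
  rest in its closure, lies in the open set. This lets zero values at boundary vertices spread to
  all boundary points of an element.\<close>

lemma vertices_of_boundary_point:
  assumes S: "S \<in> \<T>" and u: "\<And>v. v \<in> S \<Longrightarrow> 0 \<le> u v" "sum u S = 1"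
    and x: "(\<Sum>v\<in>S. u v *\<^sub>R v) \<notin> \<Omega>" and v: "v \<in> S" "v \<in> \<Omega>"
  shows "u v = 0"
proof (rule ccontr)
  assume "u v \<noteq> 0"
  then have pos: "0 < u v" using u(1)[OF v(1)] by simp
  have fin: "finite S" using finite_simplex[OF S] .
  have le1: "u v \<le> 1" using u fin v(1) member_le_sum[of v S u] by auto
  define x where "x = (\<Sum>w\<in>S. u w *\<^sub>R w)"
  have split: "x = u v *\<^sub>R v + (\<Sum>w\<in>S-{v}. u w *\<^sub>R w)" "u v + sum u (S - {v}) = 1"
    using fin v(1) u(2) by (simp_all add: x_def sum.remove[of S v])
  have "x \<in> \<Omega>"
  proof (cases "u v = 1")
    case True
    then have "sum u (S - {v}) = 0" using split by simp
    then have "\<forall>w\<in>S-{v}. u w = 0" using fin u(1) by (subst (asm) sum_nonneg_eq_0_iff) auto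
    then show ?thesis using split(1) True v by simp
  next
    case False
    \<comment> \<open>\<open>y\<close> collects the other vertices with renormalised weights, so
      that \<open>x\<close> lies on the segment from \<open>y\<close> to \<open>v\<close>.\<close>
    define y where "y = (\<Sum>w\<in>S-{v}. (u w / (1 - u v)) *\<^sub>R w)"
    have "y \<in> convex hull S" unfolding y_def
      using fin u(1) le1 False split(2)
      by (intro convex_sum) (auto simp: hull_inc sum_divide_distrib[symmetric])
    then have "y \<in> closure \<Omega>" using hull_subset_closure[OF S] by blast
    then have "y - u v *\<^sub>R (y - v) \<in> interior \<Omega>"
      using pos le1 v convex_dom open_dom
      by (intro mem_interior_closure_convex_shrink) (auto simp: interior_open)
    moreover have "(1 - u v) *\<^sub>R y = (\<Sum>w\<in>S-{v}. u w *\<^sub>R w)"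
      using False by (simp add: y_def scaleR_sum_right)
    then have "y - u v *\<^sub>R (y - v) = x" using split(1) by (simp add: algebra_simps)
    ultimately show ?thesis using interior_subset by auto
  qed
  then show False using x by (simp add: x_def)
qed

section \<open>Nodal interpolation and hat functions\<close>

lemma V0_interpolation:
  assumes c: "\<And>v. v \<notin> \<Omega> \<Longrightarrow> c v = 0"
  obtains u where "u \<in> V0 \<T> \<Omega>" "\<And>v. v \<in> \<Union>\<T> \<Longrightarrow> u v = c v"
proof -
  have "\<exists>a b. \<forall>v\<in>S. a \<bullet> v + b = c v" if "S \<in> \<T>" for S
    using simplex_interpolation[OF simplex[OF that], of c] by metis
  then obtain a b where ab: "\<And>S v. S \<in> \<T> \<Longrightarrow> v \<in> S \<Longrightarrow> a S \<bullet> v + b S = c v" by metis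
  \<comment> \<open>By conformity a common point lies in the hull of the common vertices, where both
    affine pieces take the values \<open>c\<close>.\<close>
  have agree: "a S \<bullet> x + b S = a S' \<bullet> x + b S'"
    if "S \<in> \<T>" "S' \<in> \<T>" "x \<in> convex hull S" "x \<in> convex hull S'" for S S' x
  proof (rule affine_fun_eq_on_convex_hull)
    show "x \<in> convex hull (S \<inter> S')" using that conforming by blast
  qed (use ab that in auto)
  have bd: "a S \<bullet> x + b S = 0" if S: "S \<in> \<T>" and x: "x \<in> convex hull S" "x \<notin> \<Omega>" for S x
  proof -
    from x(1) obtain u where u: "\<And>v. v \<in> S \<Longrightarrow> 0 \<le> u v" "sum u S = 1" "(\<Sum>v\<in>S. u v *\<^sub>R v) = x"
      unfolding convex_hull_finite[OF finite_simplex[OF S]] by blast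
    have "a S \<bullet> x = (\<Sum>v\<in>S. u v * (a S \<bullet> v))"
      unfolding u(3)[symmetric] by (simp add: inner_sum_right)
    then have "a S \<bullet> x + b S = (\<Sum>v\<in>S. u v * (a S \<bullet> v)) + sum u S * b S"
      using u(2) by simp
    also have "\<dots> = (\<Sum>v\<in>S. u v * (a S \<bullet> v + b S))"
      by (simp add: distrib_left sum.distrib sum_distrib_right)
    also have "\<dots> = 0"
    proof (rule sum.neutral, rule ballI)
      fix v assume "v \<in> S"
      then show "u v * (a S \<bullet> v + b S) = 0"
        using vertices_of_boundary_point[OF S u(1,2)] u(3) x(2) c ab[OF S] by (cases "v \<in> \<Omega>") auto
    qed
    finally show ?thesis .
  qed
  define T where "T x = (SOME S. S \<in> \<T> \<and> x \<in> convex hull S)" for x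
  define u where "u x = (if x \<in> \<Omega> then a (T x) \<bullet> x + b (T x) else 0)" for x
  have u: "u x = a S \<bullet> x + b S" if S: "S \<in> \<T>" "x \<in> convex hull S" for S x
  proof (cases "x \<in> \<Omega>")
    case True
    have "T x \<in> \<T> \<and> x \<in> convex hull (T x)" unfolding T_def
      by (rule someI[where P = "\<lambda>S. S \<in> \<T> \<and> x \<in> convex hull S"]) (use S in simp)
    then show ?thesis using True agree[of "T x" S x] S by (simp add: u_def)
  qed (use bd[OF S] in \<open>simp add: u_def\<close>)
  have "continuous_on (\<Union>S\<in>\<T>. convex hull S) u"
  proof (rule continuous_on_closed_Union[OF finite_mesh])
    fix S assume S: "S \<in> \<T>"
    show "closed (convex hull S)"
      using finite_simplex[OF S] by (simp add: compact_imp_closed finite_imp_compact_convex_hull)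
    have "continuous_on (convex hull S) (\<lambda>x. a S \<bullet> x + b S)" by (intro continuous_intros)
    then show "continuous_on (convex hull S) u"
      using u[OF S] continuous_on_cong[of "convex hull S" "convex hull S" u] by simp
  qed
  then have "u \<in> V0 \<T> \<Omega>"
    using u by (auto simp: V0_def cover u_def)
  moreover have "u v = c v" if "v \<in> \<Union>\<T>" for v
    using that u ab hull_inc by (metis UnionE)
  ultimately show ?thesis using that by blast
qed

lemma vertex_cases: "v \<in> \<Union>\<T> \<Longrightarrow> v \<in> interior_nodes \<T> \<Omega> \<or> v \<notin> \<Omega>"
  by (auto simp: interior_nodes_def)

lemma V0_eqI:
  assumes u: "u \<in> V0 \<T> \<Omega>" "v \<in> V0 \<T> \<Omega>"
    and eq: "\<And>z. z \<in> interior_nodes \<T> \<Omega> \<Longrightarrow> u z = v z"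
  shows "u = v"
proof
  fix x
  show "u x = v x"
  proof (cases "x \<in> \<Omega>")
    case True
    then obtain S where S: "S \<in> \<T>" "x \<in> convex hull S" using cover closure_subset by blast
    have nodes: "u p = v p" if "p \<in> S" for p
      using vertex_cases[OF UnionI[OF S(1) that]] eq V0_outside[OF u(1)] V0_outside[OF u(2)] by auto
    obtain b where b: "\<And>x. x \<in> convex hull S \<Longrightarrow> u x = simplex_grad S u \<bullet> x + b"
      using V0_simplex[OF u(1) S(1)] by blast
    obtain b' where b': "\<And>x. x \<in> convex hull S \<Longrightarrow> v x = simplex_grad S v \<bullet> x + b'"
      using V0_simplex[OF u(2) S(1)] by blast
    show ?thesis
      unfolding b[OF S(2)] b'[OF S(2)]
      by (rule affine_fun_eq_on_convex_hull[OF _ S(2)]) (use b b' nodes hull_inc in metis)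
  qed (use V0_outside[OF u(1)] V0_outside[OF u(2)] in simp)
qed

lemma hat_props:
  assumes z: "z \<in> interior_nodes \<T> \<Omega>"
  shows "hat \<T> \<Omega> z \<in> V0 \<T> \<Omega>" and "v \<in> \<Union>\<T> \<Longrightarrow> hat \<T> \<Omega> z v = of_bool (v = z)"
proof -
  let ?P = "\<lambda>\<phi>. \<phi> \<in> V0 \<T> \<Omega> \<and> \<phi> z = 1 \<and> (\<forall>z'\<in>interior_nodes \<T> \<Omega> - {z}. \<phi> z' = 0)"
  have z': "z \<in> \<Union>\<T>" "z \<in> \<Omega>" using z by (auto simp: interior_nodes_def)
  obtain u where u: "u \<in> V0 \<T> \<Omega>" "\<And>v. v \<in> \<Union>\<T> \<Longrightarrow> u v = of_bool (v = z)"
    using V0_interpolation[of "\<lambda>v. of_bool (v = z)"] z' by auto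
  have "hat \<T> \<Omega> z = u"
    unfolding hat_def
  proof (rule the_equality)
    show "?P u" using u z' by (auto simp: interior_nodes_def)
    fix \<phi> assume \<phi>: "?P \<phi>"
    show "\<phi> = u"
    proof (rule V0_eqI)
      fix p assume p: "p \<in> interior_nodes \<T> \<Omega>"
      then have "u p = of_bool (p = z)" using u by (auto simp: interior_nodes_def)
      then show "\<phi> p = u p" using \<phi> p by (cases "p = z") auto
    qed (use \<phi> u in auto)
  qed
  then show "hat \<T> \<Omega> z \<in> V0 \<T> \<Omega>" "v \<in> \<Union>\<T> \<Longrightarrow> hat \<T> \<Omega> z v = of_bool (v = z)"
    using u by auto
qed

lemma simplex_grad_hat:
  assumes "z \<in> interior_nodes \<T> \<Omega>" "S \<in> \<T>"
  shows "simplex_grad S (hat \<T> \<Omega> z) = (if z \<in> S then bary_grad S z else 0)"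
proof -
  have "simplex_grad S (hat \<T> \<Omega> z) = (\<Sum>v\<in>S. if v = z then bary_grad S v else 0)"
    unfolding simplex_grad_def
    by (intro sum.cong) (auto simp: hat_props(2)[OF assms(1) UnionI[OF assms(2)]])
  then show ?thesis using finite_simplex[OF assms(2)] by (simp add: sum.delta)
qed

lemma V0_nonneg:
  assumes u: "u \<in> V0 \<T> \<Omega>" and nodes: "\<And>v. v \<in> \<Union>\<T> \<Longrightarrow> 0 \<le> u v"
  shows "0 \<le> u x"
proof (cases "x \<in> \<Omega>")
  case True
  then obtain S where S: "S \<in> \<T>" "x \<in> convex hull S" using cover closure_subset by blast
  obtain b where b: "\<And>x. x \<in> convex hull S \<Longrightarrow> u x = simplex_grad S u \<bullet> x + b"
    using V0_simplex[OF u(1) S(1)] by blast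
  have "(- simplex_grad S u) \<bullet> x + (- b) \<le> 0"
  proof (rule affine_fun_le_on_convex_hull[OF _ S(2)])
    fix v assume v: "v \<in> S"
    then show "(- simplex_grad S u) \<bullet> v + (- b) \<le> 0"
      using b[of v] nodes[OF UnionI[OF S(1) v]] by (auto simp: hull_inc)
  qed
  then show ?thesis using b[OF S(2)] by simp
qed (use V0_outside[OF u] in simp)

text \<open>The hat function is nonnegative and, by continuity, exceeds 1/2 on a ball around its
  node. The integral is the denominator of \<open>disc_lap\<close>.\<close>

lemma integral_hat_pos:
  assumes z: "z \<in> interior_nodes \<T> \<Omega>"
  shows "0 < (LINT x:\<Omega>|lebesgue. hat \<T> \<Omega> z x)"
proof -
  define u where "u = hat \<T> \<Omega> z"
  have u: "u \<in> V0 \<T> \<Omega>" using hat_props[OF z] by (simp add: u_def)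
  have u1: "u z = 1" using hat_props(2)[OF z, of z] z by (simp add: u_def interior_nodes_def)
  have nn: "0 \<le> u x" for x
    unfolding u_def by (rule V0_nonneg[OF hat_props(1)[OF z]]) (simp add: hat_props(2)[OF z])
  have cont: "continuous_on UNIV u" by (rule V0_continuous[OF u])
  then have "isCont u z" by (simp add: continuous_on_eq_continuous_at)
  then have "\<exists>r>0. \<forall>x. dist x z < r \<longrightarrow> dist (u x) (u z) < 1/2"
    unfolding continuous_at_eps_delta by (elim allE[where x = "1/2"]) simp
  then obtain r where r: "0 < r" "\<And>x. dist x z < r \<Longrightarrow> dist (u x) (u z) < 1/2" by blast
  have int: "integrable lebesgue u"
    by (rule integrable_lebesgue_continuous_bounded_support[OF cont bounded_dom])
      (use V0_outside[OF u] in auto)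
  have "0 < (1/2) * measure lebesgue (ball z r)"
    using content_ball_pos[OF r(1), of z] by simp
  also have "\<dots> = (LINT x|lebesgue. (1/2) * indicat_real (ball z r) x)"
    by simp
  also have "\<dots> \<le> (LINT x|lebesgue. u x)"
  proof (rule integral_mono[OF _ int])
    show "integrable lebesgue (\<lambda>x. (1/2) * indicat_real (ball z r) x)"
      using lmeasurable_ball[of z r] by (auto simp: fmeasurable_def)
    fix x
    show "(1/2) * indicat_real (ball z r) x \<le> u x"
    proof (cases "x \<in> ball z r")
      case True
      then have "\<bar>u x - 1\<bar> < 1/2" using r(2)[of x] u1 by (simp add: dist_real_def dist_commute)
      then have "1/2 \<le> u x" by linarith
      then show ?thesis using True by simp
    qed (use nn in simp)
  qed
  also have "(LINT x|lebesgue. u x) = (LINT x:\<Omega>|lebesgue. u x)"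
    unfolding set_lebesgue_integral_def using V0_outside[OF u]
    by (intro Bochner_Integration.integral_cong) (auto simp: indicator_def)
  finally show ?thesis by (simp add: u_def)
qed

section \<open>The discrete Laplacian as a sum over elements\<close>

lemma grad_V0:
  assumes u: "u \<in> V0 \<T> \<Omega>" and S: "S \<in> \<T>" and x: "x \<in> interior (convex hull S)"
  shows "grad u x = simplex_grad S u"
proof -
  obtain b where b: "\<And>x. x \<in> convex hull S \<Longrightarrow> u x = simplex_grad S u \<bullet> x + b"
    using V0_simplex[OF u S] by blast
  have "((\<lambda>x. simplex_grad S u \<bullet> x + b) has_derivative (\<lambda>v. simplex_grad S u \<bullet> v)) (at x)"
    by (auto intro!: derivative_eq_intros)
  then have d: "(u has_derivative (\<lambda>v. simplex_grad S u \<bullet> v)) (at x)"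
    using b interior_subset
    by (rule_tac has_derivative_transform_within_open[OF _ open_interior x]) force+
  show ?thesis
    unfolding grad_def
  proof (rule some_equality, rule d)
    fix g assume "(u has_derivative (\<lambda>v. g \<bullet> v)) (at x)"
    then have "(\<lambda>v. g \<bullet> v) = (\<lambda>v. simplex_grad S u \<bullet> v)" using d has_derivative_unique by blast
    then show "g = simplex_grad S u" by (metis vector_eq_rdot inner_commute)
  qed
qed

text \<open>Distinct elements have equally many vertices, so they share too few for the hull of the
  common ones to have interior.\<close>

lemma disjoint_interiors:
  assumes "S \<in> \<T>" "S' \<in> \<T>" "x \<in> interior (convex hull S)" "x \<in> interior (convex hull S')"
  shows "S = S'"
proof (rule ccontr)
  assume ne: "S \<noteq> S'"
  have c: "card S = CARD('n) + 1" "card S' = CARD('n) + 1" "finite S" "finite S'"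
    using simplex assms by (auto simp: is_simplex_def)
  have "S \<inter> S' \<noteq> S" using c ne by (metis card_subset_eq inf.absorb_iff1)
  then have "card (S \<inter> S') < card S" using c by (intro psubset_card_mono) auto
  then have "interior (convex hull (S \<inter> S')) = {}"
    using c by (intro empty_interior_convex_hull) auto
  then show False using assms conforming[of S S'] by (metis IntI empty_iff interior_Int)
qed

text \<open>On element faces \<open>grad\<close> may be an unspecified value. The integrand is
  therefore controlled only off the negligible set \<open>N\<close>, where it equals the step
  function \<open>s\<close>; integrability is inherited from \<open>s\<close> as well.\<close>

lemma integral_grad_inner:
  assumes u: "u \<in> V0 \<T> \<Omega>" and v: "v \<in> V0 \<T> \<Omega>"
  shows "(LINT x:\<Omega>|lebesgue. grad u x \<bullet> grad v x) =
    (\<Sum>S\<in>\<T>. measure lebesgue (convex hull S) * (simplex_grad S u \<bullet> simplex_grad S v))"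
proof -
  define c where "c S = simplex_grad S u \<bullet> simplex_grad S v" for S
  define s where "s x = (\<Sum>S\<in>\<T>. c S * indicator (interior (convex hull S)) x)" for x
  define N where "N = (\<Union>S\<in>\<T>. frontier (convex hull S))"
  have neg: "negligible N"
    unfolding N_def using finite_mesh negligible_convex_frontier[OF convex_convex_hull]
    by (intro negligible_Union) auto
  have bdd: "bounded (convex hull S)" if "S \<in> \<T>" for S
    using finite_simplex[OF that] by (simp add: finite_imp_bounded_convex_hull)
  have lm: "interior (convex hull S) \<in> lmeasurable" if "S \<in> \<T>" for S
    using bdd[OF that] by (rule lmeasurable_interior)
  have out: "s x = 0" if "x \<notin> \<Omega>" for x
    unfolding s_def using interior_hull_subset that by (intro sum.neutral) (auto simp: indicator_def)
  then have s: "indicator \<Omega> x *\<^sub>R s x = s x" for x by (auto simp: indicator_def)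
  have ind: "integrable lebesgue (\<lambda>x. c S * indicator (interior (convex hull S)) x)" if "S \<in> \<T>" for S
    using lm[OF that] by (auto simp: fmeasurable_def)
  then have "integrable lebesgue s"
    unfolding s_def by (intro Bochner_Integration.integrable_sum) auto
  then have s_int: "s absolutely_integrable_on \<Omega>" unfolding set_integrable_def s by simp
  have spike: "grad u x \<bullet> grad v x = s x" if x: "x \<in> \<Omega> - N" for x
  proof -
    obtain S where S: "S \<in> \<T>" "x \<in> convex hull S" using x cover closure_subset by blast
    then have xi: "x \<in> interior (convex hull S)"
      using x closure_subset[of "convex hull S"] by (auto simp: N_def frontier_def)
    have "s x = (\<Sum>S'\<in>\<T>. if S' = S then c S else 0)"
      unfolding s_def
    proof (rule sum.cong[OF refl])
      fix S' assume "S' \<in> \<T>"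
      then show "c S' * indicator (interior (convex hull S')) x = (if S' = S then c S else 0)"
        using disjoint_interiors[of S' S x] S(1) xi by (cases "S' = S") (auto simp: indicator_def)
    qed
    also have "\<dots> = c S" using finite_mesh S by (simp add: sum.delta)
    finally show ?thesis using grad_V0[OF _ S(1) xi] u v by (simp add: c_def)
  qed
  have g_int: "(\<lambda>x. grad u x \<bullet> grad v x) absolutely_integrable_on \<Omega>"
    by (rule absolutely_integrable_spike[OF s_int neg spike])
  have "(LINT x:\<Omega>|lebesgue. grad u x \<bullet> grad v x) = integral \<Omega> (\<lambda>x. grad u x \<bullet> grad v x)"
    by (rule set_lebesgue_integral_eq_integral(2)[OF g_int])
  also have "\<dots> = integral \<Omega> s" by (rule integral_spike[OF neg]) (simp add: spike)
  also have "\<dots> = (LINT x:\<Omega>|lebesgue. s x)"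
    by (rule set_lebesgue_integral_eq_integral(2)[OF s_int, symmetric])
  also have "\<dots> = (LINT x|lebesgue. s x)" unfolding set_lebesgue_integral_def s ..
  also have "\<dots> = (\<Sum>S\<in>\<T>. LINT x|lebesgue. c S * indicator (interior (convex hull S)) x)"
    unfolding s_def using ind by (rule Bochner_Integration.integral_sum)
  also have "\<dots> = (\<Sum>S\<in>\<T>. measure lebesgue (convex hull S) * c S)"
    using measure_interior[OF bdd negligible_convex_frontier[OF convex_convex_hull]]
    by (intro sum.cong) auto
  finally show ?thesis by (simp add: c_def)
qed

text \<open>The common positive denominator cancels and the minus sign in \<open>disc_lap\<close>
  reverses the inequality. What remains is the stiffness row of \<open>z\<close> applied to
  \<open>u - v\<close>, supported on the elements around \<open>z\<close>.\<close>

lemma disc_lap_le_iff: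
  assumes u: "u \<in> V0 \<T> \<Omega>" and v: "v \<in> V0 \<T> \<Omega>" and z: "z \<in> interior_nodes \<T> \<Omega>"
  shows "disc_lap \<T> \<Omega> v z \<le> disc_lap \<T> \<Omega> u z \<longleftrightarrow>
    (\<Sum>S\<in>{S\<in>\<T>. z \<in> S}. measure lebesgue (convex hull S) *
      (simplex_grad S (\<lambda>x. u x - v x) \<bullet> bary_grad S z)) \<le> 0"
proof -
  let ?m = "\<lambda>S. measure lebesgue (convex hull S)"
  let ?I = "\<lambda>u. \<Sum>S\<in>\<T>. ?m S * (simplex_grad S u \<bullet> simplex_grad S (hat \<T> \<Omega> z))"
  have lap: "disc_lap \<T> \<Omega> u z = - ?I u / (LINT x:\<Omega>|lebesgue. hat \<T> \<Omega> z x)" if "u \<in> V0 \<T> \<Omega>" for u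
    unfolding disc_lap_def integral_grad_inner[OF that hat_props(1)[OF z]] by simp
  have "(\<Sum>S\<in>{S\<in>\<T>. z \<in> S}. ?m S * (simplex_grad S (\<lambda>x. u x - v x) \<bullet> bary_grad S z)) =
      ?I (\<lambda>x. u x - v x)"
    using finite_mesh by (intro sum.mono_neutral_cong_left) (auto simp: simplex_grad_hat[OF z])
  also have "\<dots> = ?I u - ?I v"
    by (simp add: simplex_grad_diff inner_diff_left right_diff_distrib sum_subtractf)
  finally show ?thesis
    using integral_hat_pos[OF z] by (auto simp: lap[OF u] lap[OF v] divide_le_cancel)
qed

end

section \<open>Comparison and policy iteration\<close>

lemma frontier_nonempty:
  fixes \<Omega> :: "'a::euclidean_space set"
  assumes "bounded \<Omega>" "\<Omega> \<noteq> {}"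
  shows "frontier \<Omega> \<noteq> {}"
  using assms frontier_eq_empty[of \<Omega>] not_bounded_UNIV by blast

context convex_mesh
begin

text \<open>At a node where \<open>u - v\<close> is maximal, weak acuteness makes every simplex contribute
  nonnegatively to the stiffness sum, so the hypothesis forces all contributions to vanish and
  the maximum propagates to whole simplices, hence to \<open>closure \<Omega>\<close> by connectedness.\<close>

lemma discrete_comparison:
  assumes acute: "weakly_acute \<T>" and u: "u \<in> V0 \<T> \<Omega>" and v: "v \<in> V0 \<T> \<Omega>"
    and super: "\<And>z. z \<in> interior_nodes \<T> \<Omega> \<Longrightarrow> (\<And>x. u x - v x \<le> u z - v z) \<Longrightarrow>
      disc_lap \<T> \<Omega> v z \<le> disc_lap \<T> \<Omega> u z"
  shows "u x \<le> v x"
proof (rule ccontr)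
  assume "\<not> u x \<le> v x"
  define d where "d y = u y - v y" for y
  have d: "d \<in> V0 \<T> \<Omega>" using V0_diff[OF u v] by (simp add: d_def[abs_def])
  have dx: "0 < d x" using \<open>\<not> u x \<le> v x\<close> by (simp add: d_def)
  then have "x \<in> \<Omega>" using V0_outside[OF d] by force
  then obtain S0 where S0: "S0 \<in> \<T>" "x \<in> convex hull S0" using cover closure_subset by blast
  define m where "m = Max (d ` \<Union>\<T>)"
  have fin: "finite (\<Union>\<T>)" using finite_mesh finite_simplex by auto
  have le: "d p \<le> m" if "S \<in> \<T>" "p \<in> S" for p S
    unfolding m_def using fin that by (intro Max_ge) auto
  have le_hull: "d y \<le> m" if S: "S \<in> \<T>" "y \<in> convex hull S" for S y
  proof -
    obtain b where b: "\<And>y. y \<in> convex hull S \<Longrightarrow> d y = simplex_grad S d \<bullet> y + b"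
      using V0_simplex[OF d S(1)] by blast
    show ?thesis unfolding b[OF S(2)]
    proof (rule affine_fun_le_on_convex_hull[OF _ S(2)])
      fix p assume "p \<in> S"
      then show "simplex_grad S d \<bullet> p + b \<le> m"
        using b[OF hull_inc] le[OF S(1)] by metis
    qed
  qed
  have m: "0 < m" using le_hull[OF S0] dx by simp
  \<comment> \<open>Here \<open>0 < m\<close> is essential: off the domain \<open>d\<close> is zero,
    so the nodal maximum is a maximum over the whole space, as \<open>super\<close> demands.\<close>
  have le_all: "d y \<le> m" for y
  proof (cases "y \<in> \<Omega>")
    case True
    then obtain S where "S \<in> \<T>" "y \<in> convex hull S" using cover closure_subset by blast
    then show ?thesis using le_hull by blast
  qed (use m V0_outside[OF d] in simp)
  have step: "d p = m" if S: "S \<in> \<T>" and z: "z \<in> S" "d z = m" and p: "p \<in> S" for S z p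
  proof -
    have Sx: "is_simplex S" using simplex[OF S] .
    obtain b where b: "\<And>y. y \<in> convex hull S \<Longrightarrow> d y = simplex_grad S d \<bullet> y + b"
      using V0_simplex[OF d S] by blast
    have ac: "bary_grad S' p \<bullet> bary_grad S' q \<le> 0"
      if "S' \<in> \<T>" "p \<in> S'" "q \<in> S'" "p \<noteq> q" for S' p q
      using weakly_acute_bary_grad[OF acute that(1) simplex[OF that(1)] that(2,3,4)] .
    have orth: "simplex_grad S d \<bullet> bary_grad S q = 0" if q: "q \<in> S" "d q = m" for q
    proof -
      \<comment> \<open>A positive maximum is never attained at a boundary vertex, so
        \<open>super\<close> applies at every maximal vertex.\<close>
      have "q \<in> \<Omega>" using V0_outside[OF d, of q] q m by auto
      then have qn: "q \<in> interior_nodes \<T> \<Omega>" using q S by (auto simp: interior_nodes_def)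
      let ?t = "\<lambda>S. measure lebesgue (convex hull S) * (simplex_grad S d \<bullet> bary_grad S q)"
      have nn: "0 \<le> ?t S'" if S': "S' \<in> {S \<in> \<T>. q \<in> S}" for S'
      proof -
        obtain b' where b': "\<And>y. y \<in> convex hull S' \<Longrightarrow> d y = simplex_grad S' d \<bullet> y + b'"
          using V0_simplex[OF d] S' by blast
        have S'T: "S' \<in> \<T>" "q \<in> S'" using S' by auto
        have "simplex_grad S' d \<bullet> p + b' = d p" if "p \<in> S'" for p
          using b'[OF hull_inc[OF that]] by simp
        from grad_at_max_vertex(2)[OF simplex[OF S'T(1)] ac[OF S'T(1)] this le[OF S'T(1)] S'T(2) q(2)]
        show ?thesis by simp
      qed
      have "u y - v y \<le> u q - v q" for y using le_all[of y] q by (simp add: d_def)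
      then have "disc_lap \<T> \<Omega> v q \<le> disc_lap \<T> \<Omega> u q" by (rule super[OF qn])
      then have "sum ?t {S \<in> \<T>. q \<in> S} \<le> 0"
        unfolding disc_lap_le_iff[OF u v qn] by (simp add: d_def[abs_def])
      then have "sum ?t {S \<in> \<T>. q \<in> S} = 0" by (intro order_antisym sum_nonneg nn)
      then have "\<forall>S'\<in>{S \<in> \<T>. q \<in> S}. ?t S' = 0"
        by (subst (asm) sum_nonneg_eq_0_iff[OF _ nn]) (use finite_mesh in simp_all)
      then have "?t S = 0" using S q by blast
      moreover have "measure lebesgue (convex hull S) \<noteq> 0"
      proof
        assume "measure lebesgue (convex hull S) = 0"
        then have "negligible (convex hull S)"
          using measurable_convex[OF convex_convex_hull finite_imp_bounded_convex_hull[OF finite_simplex[OF S]]]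
          by (simp add: negligible_iff_measure)
        then have "negligible (interior (convex hull S))"
          using interior_subset negligible_subset by blast
        then show False
          using simplex_interior_nonempty[OF Sx] open_not_negligible[OF open_interior] by blast
      qed
      ultimately show ?thesis by simp
    qed
    have "simplex_grad S d \<bullet> q + b = d q" if "q \<in> S" for q
      using b[OF hull_inc[OF that]] by simp
    from max_vertex_orthogonal_imp_constant[OF Sx ac[OF S] this le[OF S] orth z p]
    show ?thesis .
  qed
  have hull_eq: "d y = m" if S: "S \<in> \<T>" "z \<in> S" "d z = m" and y: "y \<in> convex hull S" for S z y
  proof -
    obtain b where b: "\<And>y. y \<in> convex hull S \<Longrightarrow> d y = simplex_grad S d \<bullet> y + b"
      using V0_simplex[OF d S(1)] by blast
    have "simplex_grad S d \<bullet> y + b = 0 \<bullet> y + m"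
    proof (rule affine_fun_eq_on_convex_hull[OF _ y])
      fix p assume p: "p \<in> S"
      show "simplex_grad S d \<bullet> p + b = 0 \<bullet> p + m"
        using b[OF hull_inc[OF p]] step[OF S p] by simp
    qed
    then show ?thesis using b[OF y] by simp
  qed
  have hull_less: "d y < m" if S: "S \<in> \<T>" "\<And>z. z \<in> S \<Longrightarrow> d z \<noteq> m" and y: "y \<in> convex hull S" for S y
  proof -
    obtain b where b: "\<And>y. y \<in> convex hull S \<Longrightarrow> d y = simplex_grad S d \<bullet> y + b"
      using V0_simplex[OF d S(1)] by blast
    show ?thesis unfolding b[OF y]
    proof (rule affine_fun_less_on_convex_hull[OF _ y])
      fix p assume p: "p \<in> S"
      then show "simplex_grad S d \<bullet> p + b < m"
        using b[OF hull_inc[OF p]] le[OF S(1) p] S(2)[OF p] by simp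
    qed
  qed
  \<comment> \<open>Elements with and without a maximal vertex: \<open>d\<close> equals
    \<open>m\<close> on \<open>X\<close> and stays below it on \<open>Y\<close>, so the two closed
    sets are disjoint.\<close>
  define X where "X = (\<Union>S\<in>{S\<in>\<T>. \<exists>z\<in>S. d z = m}. convex hull S)"
  define Y where "Y = (\<Union>S\<in>{S\<in>\<T>. \<forall>z\<in>S. d z \<noteq> m}. convex hull S)"
  have cl: "closed (convex hull S)" if "S \<in> \<T>" for S
    using finite_simplex[OF that] by (simp add: compact_imp_closed finite_imp_compact_convex_hull)
  have "closed X" "closed Y"
    unfolding X_def Y_def using finite_mesh cl by (auto intro!: closed_UN)
  moreover have XY: "closure \<Omega> = X \<union> Y" unfolding X_def Y_def cover[symmetric] by blast
  moreover have X: "d y = m" if "y \<in> X" for y using that hull_eq by (auto simp: X_def)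
  moreover have "d y < m" if "y \<in> Y" for y using that hull_less by (auto simp: Y_def)
  ultimately have "X \<inter> Y = {}" by fastforce
  moreover have "connected (closure \<Omega>)"
    using convex_dom by (simp add: convex_closure convex_connected)
  ultimately have "X = {} \<or> Y = {}"
    using \<open>closed X\<close> \<open>closed Y\<close> XY unfolding connected_closed by blast
  moreover have "X \<noteq> {}"
  proof -
    have "S0 \<noteq> {}" using S0 by auto
    then have "m \<in> d ` \<Union>\<T>" unfolding m_def using fin S0 by (intro Max_in) auto
    then obtain z S where "S \<in> \<T>" "z \<in> S" "d z = m" by auto
    then show ?thesis unfolding X_def using hull_inc by fastforce
  qed
  ultimately have const: "d y = m" if "y \<in> closure \<Omega>" for y using X XY that by blast
  obtain y where "y \<in> frontier \<Omega>"
    using frontier_nonempty[OF bounded_dom] \<open>x \<in> \<Omega>\<close> by blast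
  then have "y \<in> closure \<Omega>" "y \<notin> \<Omega>" using open_dom by (auto simp: frontier_def interior_open)
  then show False using const[of y] V0_outside[OF d, of y] m by simp
qed

end

text \<open>Maximality at \<open>z\<close>, used at \<open>z + y\<close> and \<open>z - y\<close>,
  orders the second differences pointwise; the nonnegative kernel and the positive determinant
  preserve the order.\<close>

lemma I_eps_mono:
  fixes \<phi> :: "real^'n \<Rightarrow> real"
  assumes \<phi>: "continuous_on UNIV \<phi>" "\<And>y. 0 \<le> \<phi> y" "\<And>y. 1 < norm y \<Longrightarrow> \<phi> y = 0"
    and eps: "0 < \<epsilon>" and M: "spd_mat (Mcoef lam A z)"
    and u: "continuous_on UNIV u" and v: "continuous_on UNIV v"
    and max: "\<And>x. u x - v x \<le> u z - v z"
  shows "I_eps \<phi> lam \<epsilon> A u z \<le> I_eps \<phi> lam \<epsilon> A v z"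
proof -
  let ?M = "Mcoef lam A z"
  let ?\<psi> = "\<lambda>y. \<phi> ((1 / \<epsilon>) *\<^sub>R (matrix_inv ?M *v y))"
  \<comment> \<open>An operator bound for \<open>?M\<close> itself, not its inverse, bounds the
    support: the kernel lives where the preimage of \<open>y\<close> has norm at most
    \<epsilon>.\<close>
  obtain B where B: "0 < B" "\<And>x. norm (?M *v x) \<le> B * norm x"
    using linear_bounded_pos[OF matrix_vector_mul_linear] by metis
  have supp: "?\<psi> y = 0" if "y \<notin> cball 0 (B * \<epsilon>)" for y
  proof (rule \<phi>(3))
    have "?M ** matrix_inv ?M = mat 1 \<and> matrix_inv ?M ** ?M = mat 1"
      using spd_mat_invertible[OF M] unfolding invertible_def matrix_inv_def by (rule someI_ex)
    then have "y = ?M *v (matrix_inv ?M *v y)" by (simp add: matrix_vector_mul_assoc)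
    then have "norm y \<le> B * norm (matrix_inv ?M *v y)" using B(2) by metis
    moreover have "B * \<epsilon> < norm y" using that by simp
    ultimately have "B * \<epsilon> < B * norm (matrix_inv ?M *v y)" by linarith
    then have "\<epsilon> < norm (matrix_inv ?M *v y)" using B(1) by simp
    then show "1 < norm ((1 / \<epsilon>) *\<^sub>R (matrix_inv ?M *v y))" using eps by simp
  qed
  have \<psi>: "continuous_on UNIV ?\<psi>"
    by (rule continuous_on_compose2[OF \<phi>(1)]) (auto intro!: continuous_intros)
  have int: "integrable lebesgue (\<lambda>y. second_diff w z y * ?\<psi> y)" if w: "continuous_on UNIV w" for w
  proof (rule integrable_lebesgue_continuous_bounded_support)
    have "continuous_on UNIV (\<lambda>y. w (z + y))" "continuous_on UNIV (\<lambda>y. w (z - y))"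
      by (rule continuous_on_compose2[OF w]; auto intro!: continuous_intros)+
    then show "continuous_on UNIV (\<lambda>y. second_diff w z y * ?\<psi> y)"
      unfolding second_diff_def by (intro continuous_intros \<psi>)
    show "bounded (cball 0 (B * \<epsilon>))" by simp
  qed (use supp in simp)
  have "second_diff u z y \<le> second_diff v z y" for y
    using max[of "z + y"] max[of "z - y"] by (simp add: second_diff_def)
  then have "(LINT y|lebesgue. second_diff u z y * ?\<psi> y) \<le> (LINT y|lebesgue. second_diff v z y * ?\<psi> y)"
    using \<phi>(2) by (intro integral_mono int u v mult_right_mono)
  moreover have "0 < \<epsilon> ^ (CARD('n) + 2) * det ?M"
    using eps spd_mat_det_pos[OF M] by simp
  ultimately show ?thesis unfolding I_eps_def by (intro divide_right_mono) auto
qed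

section \<open>Finite extrema and the policy iteration\<close>

lemma Max_image_mono:
  fixes f g :: "'b \<Rightarrow> real"
  assumes "finite B" "B \<noteq> {}" "\<And>x. x \<in> B \<Longrightarrow> f x \<le> g x"
  shows "Max (f ` B) \<le> Max (g ` B)"
  using assms by (intro Max.boundedI) (auto intro: order_trans[OF _ Max_ge])

lemma Min_image_mono:
  fixes f g :: "'b \<Rightarrow> real"
  assumes "finite B" "B \<noteq> {}" "\<And>x. x \<in> B \<Longrightarrow> f x \<le> g x"
  shows "Min (f ` B) \<le> Min (g ` B)"
  using assms by (intro Min.boundedI) (auto intro: order_trans[OF Min_le])

theorem theorem5p2:
  fixes \<Omega> :: "(real^'n) set"
    and f :: "real^'n \<Rightarrow> real"
    and \<A> :: "'a set" and \<B> :: "'b set"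
    and A :: "'a \<Rightarrow> 'b \<Rightarrow> real^'n \<Rightarrow> real^'n^'n"
    and lam Lam \<epsilon> h \<sigma> :: real
    and \<phi> :: "real^'n \<Rightarrow> real"
    and \<T> :: "(real^'n) set set"
    and w_init :: "real^'n \<Rightarrow> real"
    and w :: "nat \<Rightarrow> real^'n \<Rightarrow> real"
    and pol :: "nat \<Rightarrow> real^'n \<Rightarrow> 'a"
  assumes dim: "CARD('n) \<ge> 2"
    and \<Omega>: "open \<Omega>" "bounded \<Omega>" "convex \<Omega>" "\<Omega> \<noteq> {}"
    and f_lip: "\<exists>C. C-lipschitz_on (closure \<Omega>) f"
    and AB: "finite \<A>" "\<A> \<noteq> {}" "finite \<B>" "\<B> \<noteq> {}"
    and ellip: "0 < lam" "lam \<le> Lam"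
    and A_lip: "\<And>\<alpha> \<beta>. \<alpha> \<in> \<A> \<Longrightarrow> \<beta> \<in> \<B> \<Longrightarrow> \<exists>C. C-lipschitz_on (closure \<Omega>) (A \<alpha> \<beta>)"
    and A_sym: "\<And>\<alpha> \<beta> x. \<alpha> \<in> \<A> \<Longrightarrow> \<beta> \<in> \<B> \<Longrightarrow> x \<in> closure \<Omega> \<Longrightarrow> sym_mat (A \<alpha> \<beta> x)"
    and A_bnd: "\<And>\<alpha> \<beta> x v. \<alpha> \<in> \<A> \<Longrightarrow> \<beta> \<in> \<B> \<Longrightarrow> x \<in> closure \<Omega> \<Longrightarrow>
         lam * (v \<bullet> v) \<le> v \<bullet> (A \<alpha> \<beta> x *v v) \<and> v \<bullet> (A \<alpha> \<beta> x *v v) \<le> Lam * (v \<bullet> v)"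
    and \<phi>_smooth: "C_infty \<phi>"
    and \<phi>_radial: "\<And>x y. norm x = norm y \<Longrightarrow> \<phi> x = \<phi> y"
    and \<phi>_supp: "\<And>y. 1 < norm y \<Longrightarrow> \<phi> y = 0"
    and \<phi>_nonneg: "\<And>y. 0 \<le> \<phi> y"
    and \<phi>_moment: "(LINT y|lebesgue. (norm y)\<^sup>2 * \<phi> y) = real CARD('n)"
    and eps: "0 < \<epsilon>"
    and mesh: "simplicial_mesh \<T> \<Omega>" "weakly_acute \<T>" "quasi_uniform \<T> h \<sigma>"
    and init: "w_init \<in> V0 \<T> \<Omega>"
    and pol0: "\<And>z. z \<in> interior_nodes \<T> \<Omega> \<Longrightarrow>
         attains_inf \<phi> lam \<epsilon> A \<A> \<B> w_init z (pol 0 z)"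
    and solve: "\<And>k. w k \<in> V0 \<T> \<Omega>"
    and solve_eq: "\<And>k z. z \<in> interior_nodes \<T> \<Omega> \<Longrightarrow>
         F_pol \<T> \<Omega> \<phi> lam \<epsilon> A \<B> (pol k) (w k) z = node_val \<T> \<Omega> f z"
    and pol_upd: "\<And>k z. z \<in> interior_nodes \<T> \<Omega> \<Longrightarrow>
         attains_inf \<phi> lam \<epsilon> A \<A> \<B> (w k) z (pol (Suc k) z)"
  shows "\<exists>u \<in> V0 \<T> \<Omega>.
           (\<forall>z \<in> interior_nodes \<T> \<Omega>. F_isaacs \<T> \<Omega> \<phi> lam \<epsilon> A \<A> \<B> u z = node_val \<T> \<Omega> f z) \<and>
           (\<forall>v \<in> V0 \<T> \<Omega>.
              (\<forall>z \<in> interior_nodes \<T> \<Omega>. F_isaacs \<T> \<Omega> \<phi> lam \<epsilon> A \<A> \<B> v z = node_val \<T> \<Omega> f z)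
              \<longrightarrow> v = u) \<and>
           (\<exists>K. \<forall>k\<ge>K. w k = u)"
proof -
  interpret convex_mesh \<T> \<Omega> using \<Omega> mesh by unfold_locales auto
  let ?N = "interior_nodes \<T> \<Omega>"
  let ?FI = "F_isaacs \<T> \<Omega> \<phi> lam \<epsilon> A \<A> \<B>" and ?FP = "F_pol \<T> \<Omega> \<phi> lam \<epsilon> A \<B>"
  have \<phi>_cont: "continuous_on UNIV \<phi>"
    using \<phi>_smooth unfolding C_infty_def by (metis fold_simps(1))
  have pol_A: "pol k z \<in> \<A>" if "z \<in> ?N" for k z
    using pol0[OF that] pol_upd[OF that] by (cases k) (auto simp: attains_inf_def)
  have sup_mono: "sup_I \<phi> lam \<epsilon> A \<B> \<alpha> u z \<le> sup_I \<phi> lam \<epsilon> A \<B> \<alpha> v z"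
    if "z \<in> ?N" "\<alpha> \<in> \<A>" "u \<in> V0 \<T> \<Omega>" "v \<in> V0 \<T> \<Omega>" "\<And>x. u x - v x \<le> u z - v z" for \<alpha> u v z
  proof -
    have z: "z \<in> closure \<Omega>" using that(1) closure_subset by (auto simp: interior_nodes_def)
    have "spd_mat (Mcoef lam (A \<alpha> \<beta>) z)" if "\<beta> \<in> \<B>" for \<beta>
      using A_bnd[OF \<open>\<alpha> \<in> \<A>\<close> that z] by (intro spd_mat_Mcoef A_sym \<open>\<alpha> \<in> \<A>\<close> that z ellip) auto
    then show ?thesis
      unfolding sup_I_def
      using that by (intro Max_image_mono AB I_eps_mono \<phi>_cont \<phi>_nonneg \<phi>_supp eps V0_continuous) auto
  qed
  \<comment> \<open>\<open>J\<close> abstracts the nonlocal part, so one argument serves a fixed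
    policy and the Isaacs operator. At a maximum \<open>J\<close> is ordered against
    \<open>F\<close>, which leaves an inequality for the discrete Laplacian alone.\<close>
  have comparison: "u x \<le> v x"
    if uv: "u \<in> V0 \<T> \<Omega>" "v \<in> V0 \<T> \<Omega>"
      and J: "\<And>z. z \<in> ?N \<Longrightarrow> (\<And>x. u x - v x \<le> u z - v z) \<Longrightarrow> J u z \<le> J v z"
      and F: "\<And>z. z \<in> ?N \<Longrightarrow> lam / 2 * disc_lap \<T> \<Omega> v z + J v z \<le> lam / 2 * disc_lap \<T> \<Omega> u z + J u z"
    for u v x and J :: "(real^'n \<Rightarrow> real) \<Rightarrow> real^'n \<Rightarrow> real"
  proof (rule discrete_comparison[OF mesh(2) uv])
    fix z assume z: "z \<in> ?N" "\<And>x. u x - v x \<le> u z - v z"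
    have "lam / 2 * disc_lap \<T> \<Omega> v z \<le> lam / 2 * disc_lap \<T> \<Omega> u z"
      using J[OF z] F[OF z(1)] by linarith
    then show "disc_lap \<T> \<Omega> v z \<le> disc_lap \<T> \<Omega> u z" using ellip(1) by simp
  qed
  have pol_comparison: "u x \<le> v x"
    if "u \<in> V0 \<T> \<Omega>" "v \<in> V0 \<T> \<Omega>" "\<And>z. z \<in> ?N \<Longrightarrow> \<alpha> z \<in> \<A>"
      "\<And>z. z \<in> ?N \<Longrightarrow> ?FP \<alpha> v z \<le> ?FP \<alpha> u z" for u v x \<alpha>
    using that sup_mono
    by (intro comparison[of u v "\<lambda>u z. sup_I \<phi> lam \<epsilon> A \<B> (\<alpha> z) u z"]) (auto simp: F_pol_def)
  have isaacs_comparison: "u x \<le> v x"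
    if uv: "u \<in> V0 \<T> \<Omega>" "v \<in> V0 \<T> \<Omega>" and F: "\<And>z. z \<in> ?N \<Longrightarrow> ?FI v z \<le> ?FI u z" for u v x
  proof (rule comparison[OF uv, of "inf_sup_I \<phi> lam \<epsilon> A \<A> \<B>"])
    fix z assume z: "z \<in> ?N" "\<And>x. u x - v x \<le> u z - v z"
    show "inf_sup_I \<phi> lam \<epsilon> A \<A> \<B> u z \<le> inf_sup_I \<phi> lam \<epsilon> A \<A> \<B> v z"
      unfolding inf_sup_I_def using z uv by (intro Min_image_mono AB sup_mono)
  qed (use F in \<open>auto simp: F_isaacs_def\<close>)
  \<comment> \<open>The updated policy attains the infimum at \<open>w k\<close>, so both operators
    coincide there; monotonicity and the stationary equation both rest on this.\<close>
  have greedy: "?FP (pol (Suc k)) (w k) z = ?FI (w k) z" if "z \<in> ?N" for k z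
    using pol_upd[OF that, of k] by (simp add: F_pol_def F_isaacs_def attains_inf_def)
  have "w (Suc k) x \<le> w k x" for k x
  proof (rule pol_comparison[OF solve solve pol_A])
    fix z assume z: "z \<in> ?N"
    have "?FI (w k) z \<le> ?FP (pol k) (w k) z"
      unfolding F_isaacs_def F_pol_def inf_sup_I_def
      using AB pol_A[OF z] by (intro add_left_mono Min_le) auto
    then show "?FP (pol (Suc k)) (w k) z \<le> ?FP (pol (Suc k)) (w (Suc k)) z"
      using greedy[OF z] solve_eq[OF z] by simp
  qed
  then have anti: "w l x \<le> w k x" if "k \<le> l" for k l x
    using that lift_Suc_antimono_le[of "\<lambda>k. w k x"] by blast
  \<comment> \<open>Off the nodes \<open>pol k\<close> is arbitrary; after restriction, policies are
    elements of a finite function space and the pigeonhole principle applies.\<close>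
  define P where "P k = restrict (pol k) ?N" for k
  have wP: "w k = w l" if eq: "P k = P l" for k l
  proof
    fix x
    have pe: "pol k z = pol l z" if "z \<in> ?N" for z
      using fun_cong[OF eq, of z] that by (simp add: P_def)
    then have F: "?FP (pol l) u z = ?FP (pol k) u z" if "z \<in> ?N" for u z
      using that by (simp add: F_pol_def)
    show "w k x = w l x"
    proof (rule antisym)
      show "w k x \<le> w l x"
        by (rule pol_comparison[OF solve solve pol_A[of _ k]]) (use solve_eq F in \<open>auto simp flip: F\<close>)
      show "w l x \<le> w k x"
        by (rule pol_comparison[OF solve solve pol_A[of _ k]]) (use solve_eq F in \<open>auto simp flip: F\<close>)
    qed
  qed
  have "finite ?N"
    using finite_subset[of ?N "\<Union>\<T>"] finite_mesh finite_simplex by (auto simp: interior_nodes_def)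
  then have "finite (PiE ?N (\<lambda>_. \<A>))" using AB by (intro finite_PiE) auto
  moreover have "range P \<subseteq> PiE ?N (\<lambda>_. \<A>)" using pol_A by (auto simp: P_def)
  ultimately have "finite (range P)" by (rule finite_subset[rotated])
  then obtain k0 where "infinite {k. P k = P k0}"
    using pigeonhole_infinite[of UNIV P] by auto
  then have later: "\<exists>l\<ge>k. P l = P k0" for k
    by (metis (mono_tags, lifting) infinite_nat_iff_unbounded_le mem_Collect_eq)
  \<comment> \<open>The policy of \<open>k0\<close> recurs at some \<open>l\<close> beyond
    \<open>k\<close>, so \<open>w k\<close> is squeezed between \<open>w l\<close> and
    \<open>w k0\<close>, which are equal.\<close>
  have const: "w k = w k0" if k: "k0 \<le> k" for k
  proof
    fix x
    obtain l where l: "k \<le> l" "P l = P k0" using later by blast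
    show "w k x = w k0 x"
      using anti[OF k, of x] anti[OF l(1), of x] wP[OF l(2)] by simp
  qed
  \<comment> \<open>The iterate \<open>w (Suc k0)\<close> solves the problem of the policy that is
    greedy for \<open>w k0\<close>, and the two iterates coincide.\<close>
  have sol: "?FI (w k0) z = node_val \<T> \<Omega> f z" if "z \<in> ?N" for z
    using greedy[OF that, of k0] solve_eq[OF that, of "Suc k0"] const[of "Suc k0"] by simp
  have uniq: "v = w k0" if "v \<in> V0 \<T> \<Omega>" "\<forall>z\<in>?N. ?FI v z = node_val \<T> \<Omega> f z" for v
  proof (rule ext, rule antisym)
    fix x
    show "v x \<le> w k0 x" by (rule isaacs_comparison) (use that sol solve in auto)
    show "w k0 x \<le> v x" by (rule isaacs_comparison) (use that sol solve in auto)
  qed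
  show ?thesis using solve[of k0] sol uniq const by blast
qed

end
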